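(* Let $M$ be a monoid, let $X$ be a set, and let $R$ be a set of admissible identities over $X^*$. The map $e\mapsto D_e$, $e\in E(\mathcal{FI}_R(M))$, is an isomorphism from the semilattice $E(\mathcal{FI}_R(M))$ onto the semilattice $P(\mathcal{FR}_R(M))$. The inverse isomorphism is the restriction $\psi_R|_{P(\mathcal{FR}_R(M))}\colon P(\mathcal{FR}_R(M))\to E(\mathcal{FI}_R(M))$. In particular, $\psi_R(D_e)=e$ for all $e\in E(\mathcal{FI}_R(M))$ and $D_{\psi_R(e)}=e$ for all $e\in P(\mathcal{FR}_R(M))$.
   Context: Restriction monoids. A restriction semigroup is an algebra $(S;\cdot,{}^*,{}^+)$ with $(S;\cdot)$ a semigroup satisfying $x^+x=x$, $x^+y^+=y^+x^+$, $(x^+y)^+=x^+y^+$, $xy^+=(xy)^+x$; $xx^*=x$, $x^*y^*=y^*x^*$, $(xy^* )^*=x^*y^*$, $x^*y=y(xy)^*$; $(x^+)^*=x^+$, $(x^* )^+=x^*$. A restriction monoid is a restriction semigroup with an identity element, in signature $(\cdot,{}^*,{}^+,1)$; morphisms preserve all operations. $P(S)=\{s^*:s\in S\}=\{s^+:s\in S\}$ is the semilattice of projections. Every inverse monoid is a restriction monoid with $s^*=s^{-1}s$, $s^+=ss^{-1}$, and then $P(S)=E(S)$, the semilattice of idempotents. Identities. $X^*$ is the free monoid on a set $X$ (empty word $\lambda$), and $FR(X^* )$ is the free restriction monoid on the set $X^*$ (its product is written $\cdot$, its identity is $1\neq\lambda$; the generator $uv$ is different from the product $u\cdot v$). For a map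 $f\colon X\to M$ into a monoid, with monoid-morphism extension $\widehat f\colon X^*\to M$, and a map $\gamma\colon M\to S$ into a restriction monoid, the value $[p]_{\gamma,f}\in S$ of $p\in FR(X^* )$ is the image of $p$ under the morphism $FR(X^* )\to S$ sending each generator $u\in X^*$ to $\gamma(\widehat f(u))$. An identity over $X^*$ is an equality $p=q$ with $p,q\in FR(X^* )$; $\gamma$ satisfies it if $[p]_{\gamma,f}=[q]_{\gamma,f}$ for all $f\colon X\to M$. An identity is admissible if every monoid morphism from a monoid to a restriction monoid (i.e. map preserving $1$ and products) satisfies it. Free objects. $\mathcal{FR}_R(M)$ is the restriction monoid generated by the set $\{\lfloor m\rfloor:m\in M\}$ subject to the relations $\lfloor 1\rfloor=1$, $\lfloor m\rfloor\lfloor n\rfloor=\lfloor mn\rfloor(\lfloor m\rfloor\lfloor n\rfloor)^*$ ($m,n\in M$), and $[p]_{\iota,f}=[q]_{\iota,f}$ for all $p=q$ in $R$ and all $f\colon X\to M$, where $\iota(m)=\lfloor m\rfloor$. $\mathcal{FI}_R(M)$ is the inverse monoid generated by the set $\{[m]:m\in M\}$ subject to the relations $[1]=1$, $[m][n]=[mn]([m][n])^*$, and $[p]_{\iota,f}=[q]_{\iota,f}$ for all $p=q$ in $R$ and all $f\colon X\to M$, where $\iota(m)=[m]$. $\psi_R\colon\mathcal{FR}_R(M)\to\mathcal{FI}_R(M)$ is the morphism of restriction monoids with $\psi_R(\lfloor m\rfloor)=[m]$, $m\in M$. The elements $D_u$. For a word $u$ over the alphabet $\{[m]:m\in M\}\cup\{[m]^{-1}:m\in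 M\}$ define $D_u\in P(\mathcal{FR}_R(M))$ recursively: $D_1=1$ for the empty word; $D_{v[m]}=(D_v\lfloor m\rfloor)^*$; $D_{v[m]^{-1}}=(\lfloor m\rfloor D_v)^+$. The element $D_u$ depends only on the value of $u$ in $\mathcal{FI}_R(M)$, so $D_u$ is well defined for $u\in\mathcal{FI}_R(M)$. *)

theory Defs
  imports "HOL-Algebra.Group"
begin

section \<open>Restriction monoids\<close>

record 'a restriction_monoid = "'a monoid" +
  rstar :: "'a \<Rightarrow> 'a"
  rplus :: "'a \<Rightarrow> 'a"

locale restriction_monoid = monoid S for S (structure) +
  assumes rstar_closed: "x \<in> carrier S \<Longrightarrow> rstar S x \<in> carrier S"
    and rplus_closed: "x \<in> carrier S \<Longrightarrow> rplus S x \<in> carrier S"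
    and plus_id: "x \<in> carrier S \<Longrightarrow> rplus S x \<otimes> x = x"
    and plus_comm: "\<lbrakk>x \<in> carrier S; y \<in> carrier S\<rbrakk> \<Longrightarrow> rplus S x \<otimes> rplus S y = rplus S y \<otimes> rplus S x"
    and plus_plus: "\<lbrakk>x \<in> carrier S; y \<in> carrier S\<rbrakk> \<Longrightarrow> rplus S (rplus S x \<otimes> y) = rplus S x \<otimes> rplus S y"
    and plus_ample: "\<lbrakk>x \<in> carrier S; y \<in> carrier S\<rbrakk> \<Longrightarrow> x \<otimes> rplus S y = rplus S (x \<otimes> y) \<otimes> x"
    and star_id: "x \<in> carrier S \<Longrightarrow> x \<otimes> rstar S x = x"
    and star_comm: "\<lbrakk>x \<in> carrier S; y \<in> carrier S\<rbrakk> \<Longrightarrow> rstar S x \<otimes> rstar S y = rstar S y \<otimes> rstar S x"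
    and star_star: "\<lbrakk>x \<in> carrier S; y \<in> carrier S\<rbrakk> \<Longrightarrow> rstar S (x \<otimes> rstar S y) = rstar S x \<otimes> rstar S y"
    and star_ample: "\<lbrakk>x \<in> carrier S; y \<in> carrier S\<rbrakk> \<Longrightarrow> rstar S x \<otimes> y = y \<otimes> rstar S (x \<otimes> y)"
    and star_plus: "x \<in> carrier S \<Longrightarrow> rstar S (rplus S x) = rplus S x"
    and plus_star: "x \<in> carrier S \<Longrightarrow> rplus S (rstar S x) = rstar S x"

definition restriction_hom ::
  "('a, 'c) restriction_monoid_scheme \<Rightarrow> ('b, 'd) restriction_monoid_scheme \<Rightarrow> ('a \<Rightarrow> 'b) set" where
  "restriction_hom S T = {h \<in> hom S T. h \<one>\<^bsub>S\<^esub> = \<one>\<^bsub>T\<^esub> \<and>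
     (\<forall>x\<in>carrier S. h (rstar S x) = rstar T (h x) \<and> h (rplus S x) = rplus T (h x))}"

definition projections :: "('a, 'c) restriction_monoid_scheme \<Rightarrow> 'a set" where
  "projections S = rstar S ` carrier S"

lemma (in restriction_monoid) projections_eq_plus: "projections S = rplus S ` carrier S"
proof -
  have "rstar S x \<in> rplus S ` carrier S" if "x \<in> carrier S" for x
    by (rule image_eqI[of _ _ "rstar S x"]) (simp_all add: that plus_star rstar_closed)
  moreover have "rplus S x \<in> rstar S ` carrier S" if "x \<in> carrier S" for x
    by (rule image_eqI[of _ _ "rplus S x"]) (simp_all add: that star_plus rplus_closed)
  ultimately show ?thesis by (auto simp: projections_def)
qed

section \<open>Inverse monoids\<close>

record 'a inverse_monoid = "'a monoid" +
  minv :: "'a \<Rightarrow> 'a"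

locale inverse_monoid = monoid S for S (structure) +
  assumes minv_closed: "x \<in> carrier S \<Longrightarrow> minv S x \<in> carrier S"
    and minv_left: "x \<in> carrier S \<Longrightarrow> x \<otimes> minv S x \<otimes> x = x"
    and minv_right: "x \<in> carrier S \<Longrightarrow> minv S x \<otimes> x \<otimes> minv S x = minv S x"
    and minv_unique: "\<lbrakk>x \<in> carrier S; y \<in> carrier S; x \<otimes> y \<otimes> x = x; y \<otimes> x \<otimes> y = y\<rbrakk> \<Longrightarrow> y = minv S x"

definition idempotents :: "('a, 'c) monoid_scheme \<Rightarrow> 'a set" where
  "idempotents S = {x \<in> carrier S. x \<otimes>\<^bsub>S\<^esub> x = x}"

definition restriction_of :: "('a, 'c) inverse_monoid_scheme \<Rightarrow> 'a restriction_monoid" where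
  "restriction_of S = \<lparr>carrier = carrier S, mult = mult S, one = \<one>\<^bsub>S\<^esub>,
     rstar = (\<lambda>x. minv S x \<otimes>\<^bsub>S\<^esub> x), rplus = (\<lambda>x. x \<otimes>\<^bsub>S\<^esub> minv S x)\<rparr>"

section \<open>Restriction monoids given by generators and relations\<close>

datatype 'g rterm = Gen 'g | One | Mul "'g rterm" "'g rterm" | Star "'g rterm" | Plus "'g rterm"

abbreviation rterms :: "'g set \<Rightarrow> 'g rterm set" where
  "rterms G \<equiv> {t. set_rterm t \<subseteq> G}"

primrec reval :: "('a, 'c) restriction_monoid_scheme \<Rightarrow> ('g \<Rightarrow> 'a) \<Rightarrow> 'g rterm \<Rightarrow> 'a" where
  "reval S g (Gen x) = g x"
| "reval S g One = \<one>\<^bsub>S\<^esub>"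
| "reval S g (Mul s t) = reval S g s \<otimes>\<^bsub>S\<^esub> reval S g t"
| "reval S g (Star t) = rstar S (reval S g t)"
| "reval S g (Plus t) = rplus S (reval S g t)"

text \<open>The least congruence on the terms over \<open>G\<close> that contains \<open>r\<close> and whose quotient is a
  restriction monoid.\<close>

inductive_set rcong :: "'g set \<Rightarrow> 'g rterm rel \<Rightarrow> 'g rterm rel" for G r where
  rel: "(s, t) \<in> r \<Longrightarrow> set_rterm s \<subseteq> G \<Longrightarrow> set_rterm t \<subseteq> G \<Longrightarrow> (s, t) \<in> rcong G r"
| refl: "set_rterm t \<subseteq> G \<Longrightarrow> (t, t) \<in> rcong G r"
| sym: "(s, t) \<in> rcong G r \<Longrightarrow> (t, s) \<in> rcong G r"
| trans: "(s, t) \<in> rcong G r \<Longrightarrow> (t, u) \<in> rcong G r \<Longrightarrow> (s, u) \<in> rcong G r"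
| Mul: "(s, t) \<in> rcong G r \<Longrightarrow> (u, v) \<in> rcong G r \<Longrightarrow> (Mul s u, Mul t v) \<in> rcong G r"
| Star: "(s, t) \<in> rcong G r \<Longrightarrow> (Star s, Star t) \<in> rcong G r"
| Plus: "(s, t) \<in> rcong G r \<Longrightarrow> (Plus s, Plus t) \<in> rcong G r"
| assoc: "\<lbrakk>set_rterm x \<subseteq> G; set_rterm y \<subseteq> G; set_rterm z \<subseteq> G\<rbrakk> \<Longrightarrow> (Mul (Mul x y) z, Mul x (Mul y z)) \<in> rcong G r"
| one_l: "set_rterm x \<subseteq> G \<Longrightarrow> (Mul One x, x) \<in> rcong G r"
| one_r: "set_rterm x \<subseteq> G \<Longrightarrow> (Mul x One, x) \<in> rcong G r"
| plus_id: "set_rterm x \<subseteq> G \<Longrightarrow> (Mul (Plus x) x, x) \<in> rcong G r"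
| plus_comm: "\<lbrakk>set_rterm x \<subseteq> G; set_rterm y \<subseteq> G\<rbrakk> \<Longrightarrow> (Mul (Plus x) (Plus y), Mul (Plus y) (Plus x)) \<in> rcong G r"
| plus_plus: "\<lbrakk>set_rterm x \<subseteq> G; set_rterm y \<subseteq> G\<rbrakk> \<Longrightarrow> (Plus (Mul (Plus x) y), Mul (Plus x) (Plus y)) \<in> rcong G r"
| plus_ample: "\<lbrakk>set_rterm x \<subseteq> G; set_rterm y \<subseteq> G\<rbrakk> \<Longrightarrow> (Mul x (Plus y), Mul (Plus (Mul x y)) x) \<in> rcong G r"
| star_id: "set_rterm x \<subseteq> G \<Longrightarrow> (Mul x (Star x), x) \<in> rcong G r"
| star_comm: "\<lbrakk>set_rterm x \<subseteq> G; set_rterm y \<subseteq> G\<rbrakk> \<Longrightarrow> (Mul (Star x) (Star y), Mul (Star y) (Star x)) \<in> rcong G r"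
| star_star: "\<lbrakk>set_rterm x \<subseteq> G; set_rterm y \<subseteq> G\<rbrakk> \<Longrightarrow> (Star (Mul x (Star y)), Mul (Star x) (Star y)) \<in> rcong G r"
| star_ample: "\<lbrakk>set_rterm x \<subseteq> G; set_rterm y \<subseteq> G\<rbrakk> \<Longrightarrow> (Mul (Star x) y, Mul y (Star (Mul x y))) \<in> rcong G r"
| star_plus: "set_rterm x \<subseteq> G \<Longrightarrow> (Star (Plus x), Plus x) \<in> rcong G r"
| plus_star: "set_rterm x \<subseteq> G \<Longrightarrow> (Plus (Star x), Star x) \<in> rcong G r"

definition rpres :: "'g set \<Rightarrow> 'g rterm rel \<Rightarrow> 'g rterm set restriction_monoid" where
  "rpres G r = \<lparr>carrier = rterms G // rcong G r,
     mult = (\<lambda>A B. \<Union>a\<in>A. \<Union>b\<in>B. rcong G r `` {Mul a b}),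
     one = rcong G r `` {One},
     rstar = (\<lambda>A. \<Union>a\<in>A. rcong G r `` {Star a}),
     rplus = (\<lambda>A. \<Union>a\<in>A. rcong G r `` {Plus a})\<rparr>"

text \<open>The morphism from a presented restriction monoid to \<open>S\<close> determined by the values \<open>g\<close> of the
  generators, see \<open>rlift_hom\<close> and \<open>rlift_unique\<close> below.\<close>

definition rlift :: "('a, 'c) restriction_monoid_scheme \<Rightarrow> ('g \<Rightarrow> 'a) \<Rightarrow> 'g rterm set \<Rightarrow> 'a" where
  "rlift S g A = the_elem (reval S g ` A)"

section \<open>Inverse monoids given by generators and relations\<close>

datatype 'g iterm = IGen 'g | IOne | IMul "'g iterm" "'g iterm" | IInv "'g iterm"

abbreviation iterms :: "'g set \<Rightarrow> 'g iterm set" where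
  "iterms G \<equiv> {t. set_iterm t \<subseteq> G}"

text \<open>The rules from \<open>assoc\<close> on are the usual equational axioms of inverse monoids with the inverse
  as a unary operation; see \<open>inverse_monoid_ipres\<close> and \<open>ieval_sound\<close> below.\<close>

inductive_set icong :: "'g set \<Rightarrow> 'g iterm rel \<Rightarrow> 'g iterm rel" for G r where
  rel: "(s, t) \<in> r \<Longrightarrow> set_iterm s \<subseteq> G \<Longrightarrow> set_iterm t \<subseteq> G \<Longrightarrow> (s, t) \<in> icong G r"
| refl: "set_iterm t \<subseteq> G \<Longrightarrow> (t, t) \<in> icong G r"
| sym: "(s, t) \<in> icong G r \<Longrightarrow> (t, s) \<in> icong G r"
| trans: "(s, t) \<in> icong G r \<Longrightarrow> (t, u) \<in> icong G r \<Longrightarrow> (s, u) \<in> icong G r"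
| Mul: "(s, t) \<in> icong G r \<Longrightarrow> (u, v) \<in> icong G r \<Longrightarrow> (IMul s u, IMul t v) \<in> icong G r"
| Inv: "(s, t) \<in> icong G r \<Longrightarrow> (IInv s, IInv t) \<in> icong G r"
| assoc: "\<lbrakk>set_iterm x \<subseteq> G; set_iterm y \<subseteq> G; set_iterm z \<subseteq> G\<rbrakk> \<Longrightarrow> (IMul (IMul x y) z, IMul x (IMul y z)) \<in> icong G r"
| one_l: "set_iterm x \<subseteq> G \<Longrightarrow> (IMul IOne x, x) \<in> icong G r"
| one_r: "set_iterm x \<subseteq> G \<Longrightarrow> (IMul x IOne, x) \<in> icong G r"
| inv_id: "set_iterm x \<subseteq> G \<Longrightarrow> (IMul (IMul x (IInv x)) x, x) \<in> icong G r"
| inv_inv: "set_iterm x \<subseteq> G \<Longrightarrow> (IInv (IInv x), x) \<in> icong G r"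
| inv_mul: "\<lbrakk>set_iterm x \<subseteq> G; set_iterm y \<subseteq> G\<rbrakk> \<Longrightarrow> (IInv (IMul x y), IMul (IInv y) (IInv x)) \<in> icong G r"
| inv_comm: "\<lbrakk>set_iterm x \<subseteq> G; set_iterm y \<subseteq> G\<rbrakk> \<Longrightarrow>
    (IMul (IMul x (IInv x)) (IMul y (IInv y)), IMul (IMul y (IInv y)) (IMul x (IInv x))) \<in> icong G r"

definition ipres :: "'g set \<Rightarrow> 'g iterm rel \<Rightarrow> 'g iterm set inverse_monoid" where
  "ipres G r = \<lparr>carrier = iterms G // icong G r,
     mult = (\<lambda>A B. \<Union>a\<in>A. \<Union>b\<in>B. icong G r `` {IMul a b}),
     one = icong G r `` {IOne},
     minv = (\<lambda>A. \<Union>a\<in>A. icong G r `` {IInv a})\<rparr>"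

section \<open>Identities over \<open>X\<^sup>*\<close>\<close>

text \<open>The generators of \<open>FR(X\<^sup>*)\<close> are the words \<open>u \<in> lists X\<close>; \<open>Gen []\<close> (the generator
  \<open>\<lambda>\<close>) and \<open>One\<close>, as well as \<open>Gen (u @ v)\<close> and \<open>Mul (Gen u) (Gen v)\<close>, are not identified.\<close>

definition FR_words :: "'x set \<Rightarrow> 'x list rterm set restriction_monoid" where
  "FR_words X = rpres (lists X) {}"

definition word_ext :: "('m, 'c) monoid_scheme \<Rightarrow> ('x \<Rightarrow> 'm) \<Rightarrow> 'x list \<Rightarrow> 'm" where
  "word_ext M f u = foldr (mult M) (map f u) \<one>\<^bsub>M\<^esub>"

definition ident_value ::
  "('m, 'c) monoid_scheme \<Rightarrow> ('a, 'd) restriction_monoid_scheme \<Rightarrow> ('m \<Rightarrow> 'a) \<Rightarrow> ('x \<Rightarrow> 'm) \<Rightarrow>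
    'x list rterm set \<Rightarrow> 'a" where
  "ident_value M S \<gamma> f p = rlift S (\<lambda>u. \<gamma> (word_ext M f u)) p"

definition satisfies ::
  "'x set \<Rightarrow> ('m, 'c) monoid_scheme \<Rightarrow> ('a, 'd) restriction_monoid_scheme \<Rightarrow> ('m \<Rightarrow> 'a) \<Rightarrow>
    'x list rterm set \<times> 'x list rterm set \<Rightarrow> bool" where
  "satisfies X M S \<gamma> = (\<lambda>(p, q). \<forall>f \<in> X \<rightarrow> carrier M. ident_value M S \<gamma> f p = ident_value M S \<gamma> f q)"

definition monoid_hom :: "('m, 'c) monoid_scheme \<Rightarrow> ('a, 'd) monoid_scheme \<Rightarrow> ('m \<Rightarrow> 'a) set" where
  "monoid_hom M S = {h \<in> hom M S. h \<one>\<^bsub>M\<^esub> = \<one>\<^bsub>S\<^esub>}"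

definition identity_over :: "'x set \<Rightarrow> 'x list rterm set \<times> 'x list rterm set \<Rightarrow> bool" where
  "identity_over X pq \<longleftrightarrow> pq \<in> carrier (FR_words X) \<times> carrier (FR_words X)"

text \<open>HOL cannot quantify over types inside a formula, so the monoids range over all monoids carried
  by subsets of \<open>'x list\<close> and the restriction monoids over all those carried by subsets of
  \<open>'x rterm set\<close>. These types contain the free monoid and the free restriction monoid on \<open>X\<close>,
  hence nothing is lost: by \<open>admissible_satisfies\<close> below, an admissible identity is satisfied by
  every morphism from a monoid to a restriction monoid over arbitrary types.\<close>

definition admissible :: "'x set \<Rightarrow> 'x list rterm set \<times> 'x list rterm set \<Rightarrow> bool" where
  "admissible X pq \<longleftrightarrow> identity_over X pq \<and>
     (\<forall>(N :: 'x list monoid) (S :: 'x rterm set restriction_monoid) \<gamma>.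
        monoid N \<longrightarrow> restriction_monoid S \<longrightarrow> \<gamma> \<in> monoid_hom N S \<longrightarrow> satisfies X N S \<gamma> pq)"

section \<open>The monoids \<open>FR\<^sub>R(M)\<close> and \<open>FI\<^sub>R(M)\<close>\<close>

text \<open>The third part consists of the relations \<open>[p]\<^bsub>\<iota>,f\<^esub> = [q]\<^bsub>\<iota>,f\<^esub>\<close>: as \<open>p\<close> and \<open>q\<close> are classes
  of terms, all their representatives are used, and the term for \<open>[p]\<^bsub>\<iota>,f\<^esub>\<close> results from
  replacing every generator \<open>u\<close> by the generator that belongs to the element \<open>word_ext M f u\<close>.\<close>

definition FR_rels :: "('m, 'c) monoid_scheme \<Rightarrow> 'x set \<Rightarrow> 'x list rterm set rel \<Rightarrow> 'm rterm rel" where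
  "FR_rels M X R = {(Gen \<one>\<^bsub>M\<^esub>, One)}
    \<union> {(Mul (Gen m) (Gen n), Mul (Gen (m \<otimes>\<^bsub>M\<^esub> n)) (Star (Mul (Gen m) (Gen n)))) | m n.
         m \<in> carrier M \<and> n \<in> carrier M}
    \<union> {(map_rterm (word_ext M f) s, map_rterm (word_ext M f) t) | p q f s t.
         (p, q) \<in> R \<and> f \<in> X \<rightarrow> carrier M \<and> s \<in> p \<and> t \<in> q}"

definition FR :: "('m, 'c) monoid_scheme \<Rightarrow> 'x set \<Rightarrow> 'x list rterm set rel \<Rightarrow>
    'm rterm set restriction_monoid" where
  "FR M X R = rpres (carrier M) (FR_rels M X R)"

definition FR_gen :: "('m, 'c) monoid_scheme \<Rightarrow> 'x set \<Rightarrow> 'x list rterm set rel \<Rightarrow> 'm \<Rightarrow> 'm rterm set" where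
  "FR_gen M X R m = rcong (carrier M) (FR_rels M X R) `` {Gen m}"

text \<open>\<open>to_iterm\<close> interprets the operations \<open>s\<^sup>*\<close> and \<open>s\<^sup>+\<close> of restriction monoids in inverse
  monoids as \<open>s\<^sup>-\<^sup>1 s\<close> and \<open>s s\<^sup>-\<^sup>1\<close>; up to this, both monoids have the same relations.\<close>

primrec to_iterm :: "'g rterm \<Rightarrow> 'g iterm" where
  "to_iterm (Gen x) = IGen x"
| "to_iterm One = IOne"
| "to_iterm (Mul s t) = IMul (to_iterm s) (to_iterm t)"
| "to_iterm (Star t) = IMul (IInv (to_iterm t)) (to_iterm t)"
| "to_iterm (Plus t) = IMul (to_iterm t) (IInv (to_iterm t))"

definition FI_rels :: "('m, 'c) monoid_scheme \<Rightarrow> 'x set \<Rightarrow> 'x list rterm set rel \<Rightarrow> 'm iterm rel" where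
  "FI_rels M X R = map_prod to_iterm to_iterm ` FR_rels M X R"

definition FI :: "('m, 'c) monoid_scheme \<Rightarrow> 'x set \<Rightarrow> 'x list rterm set rel \<Rightarrow>
    'm iterm set inverse_monoid" where
  "FI M X R = ipres (carrier M) (FI_rels M X R)"

definition FI_gen :: "('m, 'c) monoid_scheme \<Rightarrow> 'x set \<Rightarrow> 'x list rterm set rel \<Rightarrow> 'm \<Rightarrow> 'm iterm set" where
  "FI_gen M X R m = icong (carrier M) (FI_rels M X R) `` {IGen m}"

definition psi :: "('m, 'c) monoid_scheme \<Rightarrow> 'x set \<Rightarrow> 'x list rterm set rel \<Rightarrow>
    'm rterm set \<Rightarrow> 'm iterm set" where
  "psi M X R = rlift (restriction_of (FI M X R)) (FI_gen M X R)"

section \<open>The elements \<open>D\<^sub>u\<close>\<close>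

datatype 'm letter = Pos 'm | Neg 'm

abbreviation letter_words :: "('m, 'c) monoid_scheme \<Rightarrow> 'm letter list set" where
  "letter_words M \<equiv> lists (Pos ` carrier M \<union> Neg ` carrier M)"

primrec letter_value :: "('m, 'c) monoid_scheme \<Rightarrow> 'x set \<Rightarrow> 'x list rterm set rel \<Rightarrow>
    'm letter \<Rightarrow> 'm iterm set" where
  "letter_value M X R (Pos m) = FI_gen M X R m"
| "letter_value M X R (Neg m) = minv (FI M X R) (FI_gen M X R m)"

definition FI_value :: "('m, 'c) monoid_scheme \<Rightarrow> 'x set \<Rightarrow> 'x list rterm set rel \<Rightarrow>
    'm letter list \<Rightarrow> 'm iterm set" where
  "FI_value M X R u = word_ext (FI M X R) (letter_value M X R) u"

primrec D_step :: "('m, 'c) monoid_scheme \<Rightarrow> 'x set \<Rightarrow> 'x list rterm set rel \<Rightarrow>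
    'm rterm set \<Rightarrow> 'm letter \<Rightarrow> 'm rterm set" where
  "D_step M X R d (Pos m) = rstar (FR M X R) (d \<otimes>\<^bsub>FR M X R\<^esub> FR_gen M X R m)"
| "D_step M X R d (Neg m) = rplus (FR M X R) (FR_gen M X R m \<otimes>\<^bsub>FR M X R\<^esub> d)"

definition D_word :: "('m, 'c) monoid_scheme \<Rightarrow> 'x set \<Rightarrow> 'x list rterm set rel \<Rightarrow>
    'm letter list \<Rightarrow> 'm rterm set" where
  "D_word M X R u = foldl (D_step M X R) \<one>\<^bsub>FR M X R\<^esub> u"

lemma D_word_simps:
  "D_word M X R [] = \<one>\<^bsub>FR M X R\<^esub>"
  "D_word M X R (v @ [Pos m]) = rstar (FR M X R) (D_word M X R v \<otimes>\<^bsub>FR M X R\<^esub> FR_gen M X R m)"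
  "D_word M X R (v @ [Neg m]) = rplus (FR M X R) (FR_gen M X R m \<otimes>\<^bsub>FR M X R\<^esub> D_word M X R v)"
  by (simp_all add: D_word_def)

text \<open>\<open>D_e\<close> for an element \<open>e\<close> of \<open>FI\<^sub>R(M)\<close>: the common value of \<open>D_u\<close> for all words \<open>u\<close> that
  represent \<open>e\<close>.\<close>

definition D :: "('m, 'c) monoid_scheme \<Rightarrow> 'x set \<Rightarrow> 'x list rterm set rel \<Rightarrow>
    'm iterm set \<Rightarrow> 'm rterm set" where
  "D M X R e = (THE d. \<exists>u \<in> letter_words M. FI_value M X R u = e \<and> d = D_word M X R u)"

section \<open>Basic facts\<close>

subsection \<open>Presented restriction monoids and their universal property\<close>

lemma rcong_terms: "(s, t) \<in> rcong G r \<Longrightarrow> s \<in> rterms G \<and> t \<in> rterms G"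
  by (induction rule: rcong.induct) auto

lemma equiv_rcong: "equiv (rterms G) (rcong G r)"
proof (rule equivI)
  show "rcong G r \<subseteq> rterms G \<times> rterms G" using rcong_terms by fast
  show "refl_on (rterms G) (rcong G r)"
    by (auto simp: refl_on_def intro: rcong.refl)
  show "sym (rcong G r)" by (auto simp: sym_def intro: rcong.sym)
  show "trans (rcong G r)" by (auto simp: trans_def intro: rcong.trans)
qed

lemma rclass_eq_iff:
  "s \<in> rterms G \<Longrightarrow> t \<in> rterms G \<Longrightarrow> rcong G r `` {s} = rcong G r `` {t} \<longleftrightarrow> (s, t) \<in> rcong G r"
  by (rule eq_equiv_class_iff[OF equiv_rcong])

lemma rpres_carrierE:
  assumes "A \<in> carrier (rpres G r)"
  obtains t where "t \<in> rterms G" "A = rcong G r `` {t}"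
  using assms by (auto simp: rpres_def elim: quotientE)

lemma rclass_carrier: "t \<in> rterms G \<Longrightarrow> rcong G r `` {t} \<in> carrier (rpres G r)"
  by (simp add: rpres_def quotientI)

lemma rpres_one: "\<one>\<^bsub>rpres G r\<^esub> = rcong G r `` {One}"
  by (simp add: rpres_def)

lemma rpres_mult:
  assumes "s \<in> rterms G" "t \<in> rterms G"
  shows "rcong G r `` {s} \<otimes>\<^bsub>rpres G r\<^esub> rcong G r `` {t} = rcong G r `` {Mul s t}"
  unfolding rpres_def monoid.simps
  by (rule UN_equiv_class2[OF equiv_rcong equiv_rcong _ assms])
    (auto intro!: congruent2I' equiv_class_eq[OF equiv_rcong] rcong.Mul)

lemma rpres_star:
  assumes "s \<in> rterms G"
  shows "rstar (rpres G r) (rcong G r `` {s}) = rcong G r `` {Star s}"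
  unfolding rpres_def restriction_monoid.simps
  by (rule UN_equiv_class[OF equiv_rcong _ assms])
    (auto intro!: congruentI equiv_class_eq[OF equiv_rcong] rcong.Star)

lemma rpres_plus:
  assumes "s \<in> rterms G"
  shows "rplus (rpres G r) (rcong G r `` {s}) = rcong G r `` {Plus s}"
  unfolding rpres_def restriction_monoid.simps
  by (rule UN_equiv_class[OF equiv_rcong _ assms])
    (auto intro!: congruentI equiv_class_eq[OF equiv_rcong] rcong.Plus)

lemmas rpres_simps = rpres_one rpres_mult rpres_star rpres_plus

lemma restriction_monoid_rpres: "restriction_monoid (rpres G r)"
  by (unfold_locales; (elim rpres_carrierE)?;
    simp add: rpres_simps rclass_carrier rclass_eq_iff rcong.assoc rcong.one_l rcong.one_r
      rcong.plus_id rcong.plus_comm rcong.plus_plus rcong.plus_ample rcong.star_id rcong.star_comm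
      rcong.star_star rcong.star_ample rcong.star_plus rcong.plus_star)

lemma reval_closed:
  assumes "restriction_monoid S" "g \<in> G \<rightarrow> carrier S" "t \<in> rterms G"
  shows "reval S g t \<in> carrier S"
proof -
  interpret restriction_monoid S by fact
  show ?thesis using assms(3)
    by (induction t) (use assms(2) in \<open>auto intro: rstar_closed rplus_closed\<close>)
qed

lemma reval_sound:
  assumes S: "restriction_monoid S" and g: "g \<in> G \<rightarrow> carrier S"
    and r: "\<And>s t. (s, t) \<in> r \<Longrightarrow> reval S g s = reval S g t"
    and st: "(s, t) \<in> rcong G r"
  shows "reval S g s = reval S g t"
proof -
  interpret restriction_monoid S by fact
  note c = reval_closed[OF S g]
  show ?thesis using st
  proof (induction rule: rcong.induct)
    case (rel s t) then show ?case using r by blast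
  qed (simp_all only: reval.simps,
      (rule m_assoc l_one r_one plus_id plus_comm plus_plus plus_ample star_id star_comm star_star
        star_ample star_plus plus_star; intro c CollectI; assumption)+)
qed

lemma rlift_class:
  assumes "restriction_monoid S" "g \<in> G \<rightarrow> carrier S"
    and "\<And>s t. (s, t) \<in> r \<Longrightarrow> reval S g s = reval S g t" and t: "t \<in> rterms G"
  shows "rlift S g (rcong G r `` {t}) = reval S g t"
  unfolding rlift_def
proof (rule the_elem_image_unique)
  show "rcong G r `` {t} \<noteq> {}" using t by (auto intro: rcong.refl)
  fix s assume "s \<in> rcong G r `` {t}"
  then have "(t, s) \<in> rcong G r" by simp
  from reval_sound[OF assms(1-3) this] show "reval S g s = reval S g t" by simp
qed

theorem rlift_hom:
  assumes S: "restriction_monoid S" and g: "g \<in> G \<rightarrow> carrier S"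
    and r: "\<And>s t. (s, t) \<in> r \<Longrightarrow> reval S g s = reval S g t"
  shows "rlift S g \<in> restriction_hom (rpres G r) S"
    and "x \<in> G \<Longrightarrow> rlift S g (rcong G r `` {Gen x}) = g x"
proof -
  note [simp] = rlift_class[OF S g r] rpres_simps
  show "rlift S g \<in> restriction_hom (rpres G r) S"
    unfolding restriction_hom_def hom_def
    by (auto elim!: rpres_carrierE intro: reval_closed[OF S g])
  show "x \<in> G \<Longrightarrow> rlift S g (rcong G r `` {Gen x}) = g x" by simp
qed

theorem rlift_unique:
  assumes S: "restriction_monoid S" and g: "g \<in> G \<rightarrow> carrier S"
    and r: "\<And>s t. (s, t) \<in> r \<Longrightarrow> reval S g s = reval S g t"
    and h: "h \<in> restriction_hom (rpres G r) S"
    and hg: "\<And>x. x \<in> G \<Longrightarrow> h (rcong G r `` {Gen x}) = g x"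
    and A: "A \<in> carrier (rpres G r)"
  shows "h A = rlift S g A"
proof -
  obtain t where t: "t \<in> rterms G" "A = rcong G r `` {t}" using A by (rule rpres_carrierE)
  have "h (rcong G r `` {t}) = reval S g t" using t(1)
  proof (induction t)
    case (Mul s t)
    then have c: "s \<in> rterms G" "t \<in> rterms G" by auto
    have "h (rcong G r `` {s} \<otimes>\<^bsub>rpres G r\<^esub> rcong G r `` {t}) =
        h (rcong G r `` {s}) \<otimes>\<^bsub>S\<^esub> h (rcong G r `` {t})"
      using h c by (simp add: restriction_hom_def hom_def rclass_carrier)
    then show ?case using Mul c by (simp add: rpres_mult)
  next
    case (Star t)
    then have c: "t \<in> rterms G" by auto
    have "h (rstar (rpres G r) (rcong G r `` {t})) = rstar S (h (rcong G r `` {t}))"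
      using h c by (simp add: restriction_hom_def rclass_carrier)
    then show ?case using Star c by (simp add: rpres_star)
  next
    case (Plus t)
    then have c: "t \<in> rterms G" by auto
    have "h (rplus (rpres G r) (rcong G r `` {t})) = rplus S (h (rcong G r `` {t}))"
      using h c by (simp add: restriction_hom_def rclass_carrier)
    then show ?case using Plus c by (simp add: rpres_plus)
  qed (use h hg in \<open>auto simp: restriction_hom_def rpres_one\<close>)
  then show ?thesis using t rlift_class[OF S g r t(1)] by simp
qed

subsection \<open>Admissible identities\<close>

lemma word_ext_simps [simp]:
  "word_ext M f [] = \<one>\<^bsub>M\<^esub>" "word_ext M f (x # u) = f x \<otimes>\<^bsub>M\<^esub> word_ext M f u"
  by (simp_all add: word_ext_def)

lemma word_ext_closed:
  assumes "monoid M" "f \<in> X \<rightarrow> carrier M" "u \<in> lists X"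
  shows "word_ext M f u \<in> carrier M"
proof -
  interpret monoid M by fact
  show ?thesis using assms(3) by (induction u) (use assms(2) in auto)
qed

lemma identity_overE:
  assumes "identity_over X (p, q)"
  obtains s t where "s \<in> rterms (lists X)" "t \<in> rterms (lists X)"
    "p = rcong (lists X) {} `` {s}" "q = rcong (lists X) {} `` {t}"
  using assms by (auto simp: identity_over_def FR_words_def elim!: rpres_carrierE)

lemma ident_value_class:
  assumes "monoid M" "restriction_monoid S" "\<gamma> \<in> carrier M \<rightarrow> carrier S" "f \<in> X \<rightarrow> carrier M"
    and "s \<in> rterms (lists X)"
  shows "ident_value M S \<gamma> f (rcong (lists X) {} `` {s}) = reval S (\<lambda>u. \<gamma> (word_ext M f u)) s"
  unfolding ident_value_def
proof (rule rlift_class[OF assms(2) _ _ assms(5)])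
  show "(\<lambda>u. \<gamma> (word_ext M f u)) \<in> lists X \<rightarrow> carrier S"
    using word_ext_closed[OF assms(1,4)] assms(3) by (blast intro: funcset_mem)
qed simp

primrec gen_word :: "'x list \<Rightarrow> 'x rterm" where
  "gen_word [] = One"
| "gen_word (x # u) = Mul (Gen x) (gen_word u)"

primrec expand :: "'x list rterm \<Rightarrow> 'x rterm" where
  "expand (Gen u) = gen_word u"
| "expand One = One"
| "expand (Mul s t) = Mul (expand s) (expand t)"
| "expand (Star t) = Star (expand t)"
| "expand (Plus t) = Plus (expand t)"

lemma set_gen_word [simp]: "set_rterm (gen_word u) = set u"
  by (induction u) auto

lemma gen_word_terms: "u \<in> lists X \<Longrightarrow> gen_word u \<in> rterms X"
  by auto

lemma expand_terms: "t \<in> rterms (lists X) \<Longrightarrow> expand t \<in> rterms X"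
  by (induction t) auto

lemma gen_word_append:
  assumes "u \<in> lists X" "v \<in> lists X"
  shows "(gen_word (u @ v), Mul (gen_word u) (gen_word v)) \<in> rcong X r"
  using assms(1)
proof (induction u)
  case Nil
  have "(Mul One (gen_word v), gen_word v) \<in> rcong X r"
    by (rule rcong.one_l) (use assms(2) in auto)
  then show ?case by (auto intro: rcong.sym)
next
  case (Cons x u)
  have "(Mul (Gen x) (gen_word (u @ v)), Mul (Gen x) (Mul (gen_word u) (gen_word v))) \<in> rcong X r"
    using Cons by (intro rcong.Mul rcong.refl) auto
  moreover have "(Mul (Gen x) (Mul (gen_word u) (gen_word v)),
      Mul (Mul (Gen x) (gen_word u)) (gen_word v)) \<in> rcong X r"
    using Cons gen_word_terms[OF assms(2)] gen_word_terms[of u X]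
    by (intro rcong.sym[OF rcong.assoc]) auto
  ultimately show ?case by (auto intro: rcong.trans)
qed

theorem admissible_satisfies:
  fixes X :: "'x set" and M :: "('m, 'c) monoid_scheme" and S :: "('a, 'd) restriction_monoid_scheme"
  assumes adm: "admissible X pq" and M: "monoid M" and S: "restriction_monoid S"
    and \<gamma>: "\<gamma> \<in> monoid_hom M S"
  shows "satisfies X M S \<gamma> pq"
proof -
  obtain p q where pq: "pq = (p, q)" by (cases pq)
  have id: "identity_over X (p, q)" using adm pq by (simp add: admissible_def)
  then obtain s t where st: "s \<in> rterms (lists X)" "t \<in> rterms (lists X)"
    "p = rcong (lists X) {} `` {s}" "q = rcong (lists X) {} `` {t}" by (rule identity_overE)
  define N :: "'x list monoid" where "N = \<lparr>carrier = lists X, mult = (@), one = []\<rparr>"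
  have N: "monoid N" by unfold_locales (auto simp: N_def)
  let ?F = "rpres X {}"
  have F: "restriction_monoid ?F" by (rule restriction_monoid_rpres)
  define \<delta> where "\<delta> u = rcong X {} `` {gen_word u}" for u
  have \<delta>: "\<delta> \<in> monoid_hom N ?F"
    unfolding monoid_hom_def hom_def
  proof (intro CollectI conjI ballI Pi_I)
    fix u v assume "u \<in> carrier N" "v \<in> carrier N"
    then have uv: "u \<in> lists X" "v \<in> lists X" by (simp_all add: N_def)
    have "\<delta> (u @ v) = rcong X {} `` {Mul (gen_word u) (gen_word v)}"
      unfolding \<delta>_def by (rule equiv_class_eq[OF equiv_rcong gen_word_append[OF uv]])
    then show "\<delta> (u \<otimes>\<^bsub>N\<^esub> v) = \<delta> u \<otimes>\<^bsub>?F\<^esub> \<delta> v"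
      using rpres_mult[OF uv[THEN gen_word_terms]] by (simp add: N_def \<delta>_def)
  qed (auto simp: N_def \<delta>_def rpres_one intro!: rclass_carrier)
  have sat: "satisfies X N ?F \<delta> (p, q)"
    using adm N F \<delta> unfolding admissible_def pq by blast
  have w: "word_ext N (\<lambda>x. [x]) u = u" for u by (induction u) (auto simp: N_def)
  have f0: "(\<lambda>x. [x]) \<in> X \<rightarrow> carrier N" by (auto simp: N_def)
  have \<delta>c: "\<delta> \<in> carrier N \<rightarrow> carrier ?F" using \<delta> by (auto simp: monoid_hom_def hom_def)
  have ev: "reval ?F \<delta> a = rcong X {} `` {expand a}" if "a \<in> rterms (lists X)" for a
    using that by (induction a) (simp_all add: \<delta>_def rpres_simps expand_terms[unfolded mem_Collect_eq])
  have "reval ?F \<delta> s = reval ?F \<delta> t"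
    using sat f0 ident_value_class[OF N F \<delta>c f0 st(1)] ident_value_class[OF N F \<delta>c f0 st(2)]
    by (auto simp: satisfies_def st(3,4) w)
  then have cong: "(expand s, expand t) \<in> rcong X {}"
    using ev st rclass_eq_iff[of "expand s" X "expand t" "{}"] expand_terms by metis
  show ?thesis unfolding pq satisfies_def prod.case
  proof
    fix f assume f: "f \<in> X \<rightarrow> carrier M"
    have \<gamma>c: "\<gamma> \<in> carrier M \<rightarrow> carrier S" using \<gamma> by (auto simp: monoid_hom_def hom_def)
    have gf: "(\<lambda>x. \<gamma> (f x)) \<in> X \<rightarrow> carrier S" using f \<gamma>c by auto
    have gw: "reval S (\<lambda>x. \<gamma> (f x)) (gen_word u) = \<gamma> (word_ext M f u)" if "u \<in> lists X" for u
      using that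
      by (induction u) (use f \<gamma> word_ext_closed[OF M f] in \<open>auto simp: monoid_hom_def hom_def Pi_iff\<close>)
    have ex: "reval S (\<lambda>x. \<gamma> (f x)) (expand a) = reval S (\<lambda>u. \<gamma> (word_ext M f u)) a"
      if "a \<in> rterms (lists X)" for a using that by (induction a) (auto simp: gw)
    have "reval S (\<lambda>x. \<gamma> (f x)) (expand s) = reval S (\<lambda>x. \<gamma> (f x)) (expand t)"
      by (rule reval_sound[OF S gf _ cong]) simp
    then show "ident_value M S \<gamma> f p = ident_value M S \<gamma> f q"
      using st ex ident_value_class[OF M S \<gamma>c f] by metis
  qed
qed

subsection \<open>Inverse monoids as restriction monoids\<close>

context inverse_monoid
begin

lemma minv_minv: "x \<in> carrier S \<Longrightarrow> minv S (minv S x) = x"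
  using minv_unique[of "minv S x" x] minv_left minv_right minv_closed by simp

lemma minv_idem: "e \<in> carrier S \<Longrightarrow> e \<otimes> e = e \<Longrightarrow> minv S e = e"
  using minv_unique[of e e] by simp

lemma idem_mult:
  assumes e: "e \<in> carrier S" "e \<otimes> e = e" and f: "f \<in> carrier S" "f \<otimes> f = f"
  shows "(e \<otimes> f) \<otimes> (e \<otimes> f) = e \<otimes> f"
proof -
  define x where "x = minv S (e \<otimes> f)"
  have x: "x \<in> carrier S" using e f by (simp add: x_def minv_closed)
  have l: "e \<otimes> f \<otimes> x \<otimes> (e \<otimes> f) = e \<otimes> f" and r: "x \<otimes> (e \<otimes> f) \<otimes> x = x"
    using minv_left minv_right e f by (auto simp: x_def)
  have ee: "e \<otimes> (e \<otimes> z) = e \<otimes> z" and ff: "f \<otimes> (f \<otimes> z) = f \<otimes> z" if "z \<in> carrier S" for z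
    using e f that by (simp_all flip: m_assoc)
  have rr: "x \<otimes> (e \<otimes> (f \<otimes> (x \<otimes> z))) = x \<otimes> z" if "z \<in> carrier S" for z
    using arg_cong[OF r, of "\<lambda>y. y \<otimes> z"] e f x that by (simp add: m_assoc)
  have "f \<otimes> x \<otimes> e = minv S (e \<otimes> f)"
    by (rule minv_unique) (use e f x l in \<open>simp_all add: m_assoc ee ff rr\<close>)
  then have fxe: "f \<otimes> x \<otimes> e = x" by (simp add: x_def)
  have "(f \<otimes> x \<otimes> e) \<otimes> (f \<otimes> x \<otimes> e) = f \<otimes> x \<otimes> e" using e f x by (simp add: m_assoc rr)
  then have xx: "x \<otimes> x = x" by (simp add: fxe)
  have "e \<otimes> f = minv S x" using minv_minv e f by (simp add: x_def)
  then show ?thesis using xx minv_idem[OF x xx] by simp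
qed

lemma idem_comm:
  assumes e: "e \<in> carrier S" "e \<otimes> e = e" and f: "f \<in> carrier S" "f \<otimes> f = f"
  shows "e \<otimes> f = f \<otimes> e"
proof -
  have ef: "e \<otimes> f \<otimes> (e \<otimes> f) = e \<otimes> f" and fe: "f \<otimes> e \<otimes> (f \<otimes> e) = f \<otimes> e"
    using idem_mult assms by auto
  have ee: "e \<otimes> (e \<otimes> z) = e \<otimes> z" and ff: "f \<otimes> (f \<otimes> z) = f \<otimes> z" if "z \<in> carrier S" for z
    using e f that by (simp_all flip: m_assoc)
  have "f \<otimes> e = minv S (e \<otimes> f)"
    by (rule minv_unique) (use e f ef fe in \<open>simp_all add: m_assoc ee ff\<close>)
  then show ?thesis using minv_idem[OF _ ef] e f by simp
qed

lemma idem_r: "x \<in> carrier S \<Longrightarrow> x \<otimes> minv S x \<otimes> (x \<otimes> minv S x) = x \<otimes> minv S x"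
  using minv_left[of x] minv_closed[of x] by (simp flip: m_assoc)

lemma idem_l: "x \<in> carrier S \<Longrightarrow> minv S x \<otimes> x \<otimes> (minv S x \<otimes> x) = minv S x \<otimes> x"
  using minv_right[of x] minv_closed[of x] by (simp flip: m_assoc)

lemma comm_lr:
  assumes "x \<in> carrier S" "y \<in> carrier S"
  shows "(minv S x \<otimes> x) \<otimes> (y \<otimes> minv S y) = (y \<otimes> minv S y) \<otimes> (minv S x \<otimes> x)"
  by (rule idem_comm) (use assms minv_closed idem_l idem_r in auto)

lemma minv_mult:
  assumes x: "x \<in> carrier S" and y: "y \<in> carrier S"
  shows "minv S (x \<otimes> y) = minv S y \<otimes> minv S x"
proof -
  let ?x = "minv S x" and ?y = "minv S y"
  note c = x y minv_closed[OF x] minv_closed[OF y]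
  have "x \<otimes> y \<otimes> (?y \<otimes> ?x) \<otimes> (x \<otimes> y) = x \<otimes> ((y \<otimes> ?y) \<otimes> (?x \<otimes> x)) \<otimes> y"
    using c by (simp add: m_assoc)
  also have "\<dots> = (x \<otimes> ?x \<otimes> x) \<otimes> (y \<otimes> ?y \<otimes> y)"
    unfolding comm_lr[OF x y, symmetric] using c by (simp add: m_assoc)
  finally have 1: "x \<otimes> y \<otimes> (?y \<otimes> ?x) \<otimes> (x \<otimes> y) = x \<otimes> y" using x y minv_left by simp
  have "?y \<otimes> ?x \<otimes> (x \<otimes> y) \<otimes> (?y \<otimes> ?x) = ?y \<otimes> ((?x \<otimes> x) \<otimes> (y \<otimes> ?y)) \<otimes> ?x"
    using c by (simp add: m_assoc)
  also have "\<dots> = (?y \<otimes> y \<otimes> ?y) \<otimes> (?x \<otimes> x \<otimes> ?x)"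
    unfolding comm_lr[OF x y] using c by (simp add: m_assoc)
  finally have 2: "?y \<otimes> ?x \<otimes> (x \<otimes> y) \<otimes> (?y \<otimes> ?x) = ?y \<otimes> ?x" using x y minv_right by simp
  show ?thesis using minv_unique[of "x \<otimes> y" "?y \<otimes> ?x"] 1 2 c by simp
qed

lemma restriction_monoid_restriction_of: "restriction_monoid (restriction_of S)"
proof -
  let ?p = "\<lambda>x. x \<otimes> minv S x" and ?s = "\<lambda>x. minv S x \<otimes> x"
  have pc: "?p x \<in> carrier S" and sc: "?s x \<in> carrier S" if "x \<in> carrier S" for x
    using that minv_closed by auto
  have mp: "minv S (?p x) = ?p x" and ms: "minv S (?s x) = ?s x" if "x \<in> carrier S" for x
    using that minv_idem pc sc idem_r idem_l by auto
  have pcomm: "?p x \<otimes> ?p y = ?p y \<otimes> ?p x" and scomm: "?s x \<otimes> ?s y = ?s y \<otimes> ?s x"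
    if "x \<in> carrier S" "y \<in> carrier S" for x y
    using that idem_comm pc sc idem_r idem_l by auto
  have pp: "?p (?p x \<otimes> y) = ?p x \<otimes> ?p y" if x: "x \<in> carrier S" and y: "y \<in> carrier S" for x y
  proof -
    have "?p (?p x \<otimes> y) = ?p x \<otimes> y \<otimes> (minv S y \<otimes> ?p x)"
      using minv_mult[OF pc[OF x] y] mp[OF x] by simp
    also have "\<dots> = ?p x \<otimes> (?p y \<otimes> ?p x)" using x y minv_closed by (simp add: m_assoc)
    also have "\<dots> = ?p x \<otimes> (?p x \<otimes> ?p y)" using pcomm[OF x y] by simp
    also have "\<dots> = ?p x \<otimes> ?p x \<otimes> ?p y"
      using m_assoc[OF pc[OF x] pc[OF x] pc[OF y]] by simp
    finally show ?thesis using idem_r[OF x] by simp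
  qed
  have ss: "?s (x \<otimes> ?s y) = ?s x \<otimes> ?s y" if x: "x \<in> carrier S" and y: "y \<in> carrier S" for x y
  proof -
    have "?s (x \<otimes> ?s y) = (?s y \<otimes> minv S x) \<otimes> (x \<otimes> ?s y)"
      using minv_mult[OF x sc[OF y]] ms[OF y] by simp
    also have "\<dots> = (?s y \<otimes> ?s x) \<otimes> ?s y" using x y minv_closed by (simp add: m_assoc)
    also have "\<dots> = (?s x \<otimes> ?s y) \<otimes> ?s y" using scomm[OF x y] by simp
    also have "\<dots> = ?s x \<otimes> (?s y \<otimes> ?s y)"
      using m_assoc[OF sc[OF x] sc[OF y] sc[OF y]] by simp
    finally show ?thesis using idem_l[OF y] by simp
  qed
  have pa: "x \<otimes> ?p y = ?p (x \<otimes> y) \<otimes> x" if x: "x \<in> carrier S" and y: "y \<in> carrier S" for x y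
  proof -
    have "?p (x \<otimes> y) \<otimes> x = x \<otimes> (?p y \<otimes> ?s x)"
      using x y minv_closed by (simp add: minv_mult m_assoc)
    also have "\<dots> = (x \<otimes> minv S x \<otimes> x) \<otimes> ?p y"
      unfolding comm_lr[OF x y, symmetric] using x y minv_closed by (simp add: m_assoc)
    finally show ?thesis using minv_left[OF x] by simp
  qed
  have sa: "?s x \<otimes> y = y \<otimes> ?s (x \<otimes> y)" if x: "x \<in> carrier S" and y: "y \<in> carrier S" for x y
  proof -
    have "y \<otimes> ?s (x \<otimes> y) = (?p y \<otimes> ?s x) \<otimes> y"
      using x y minv_closed by (simp add: minv_mult m_assoc)
    also have "\<dots> = ?s x \<otimes> (y \<otimes> minv S y \<otimes> y)"
      unfolding comm_lr[OF x y, symmetric] using x y minv_closed by (simp add: m_assoc)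
    finally show ?thesis using minv_left[OF y] by simp
  qed
  have sp: "?s (?p x) = ?p x" and ps: "?p (?s x) = ?s x" if "x \<in> carrier S" for x
    using mp[OF that] ms[OF that] idem_r[OF that] idem_l[OF that] by simp_all
  have sid: "x \<otimes> ?s x = x" if "x \<in> carrier S" for x
    using that minv_left[OF that] minv_closed by (simp add: m_assoc)
  show ?thesis
    by (unfold_locales; simp only: restriction_of_def partial_object.simps monoid.simps restriction_monoid.simps;
      (rule m_closed one_closed m_assoc l_one r_one pc sc minv_left pcomm scomm pp ss pa sa sp ps sid;
        assumption)?)
qed

end

subsection \<open>Presented inverse monoids\<close>

lemma icong_terms: "(s, t) \<in> icong G r \<Longrightarrow> s \<in> iterms G \<and> t \<in> iterms G"
  by (induction rule: icong.induct) auto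

lemma equiv_icong: "equiv (iterms G) (icong G r)"
proof (rule equivI)
  show "icong G r \<subseteq> iterms G \<times> iterms G" using icong_terms by fast
  show "refl_on (iterms G) (icong G r)"
    by (auto simp: refl_on_def intro: icong.refl)
  show "sym (icong G r)" by (auto simp: sym_def intro: icong.sym)
  show "trans (icong G r)" by (auto simp: trans_def intro: icong.trans)
qed

lemma iclass_eq_iff:
  "s \<in> iterms G \<Longrightarrow> t \<in> iterms G \<Longrightarrow> icong G r `` {s} = icong G r `` {t} \<longleftrightarrow> (s, t) \<in> icong G r"
  by (rule eq_equiv_class_iff[OF equiv_icong])

lemma iclass_carrier: "t \<in> iterms G \<Longrightarrow> icong G r `` {t} \<in> carrier (ipres G r)"
  by (simp add: ipres_def quotientI)

lemma ipres_carrierE: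
  assumes "A \<in> carrier (ipres G r)"
  obtains t where "t \<in> iterms G" "A = icong G r `` {t}"
  using assms by (auto simp: ipres_def elim: quotientE)

lemma ipres_one: "\<one>\<^bsub>ipres G r\<^esub> = icong G r `` {IOne}"
  by (simp add: ipres_def)

lemma ipres_mult:
  assumes "s \<in> iterms G" "t \<in> iterms G"
  shows "icong G r `` {s} \<otimes>\<^bsub>ipres G r\<^esub> icong G r `` {t} = icong G r `` {IMul s t}"
  unfolding ipres_def monoid.simps
  by (rule UN_equiv_class2[OF equiv_icong equiv_icong _ assms])
    (auto intro!: congruent2I' equiv_class_eq[OF equiv_icong] icong.Mul)

lemma ipres_minv:
  assumes "s \<in> iterms G"
  shows "minv (ipres G r) (icong G r `` {s}) = icong G r `` {IInv s}"
  unfolding ipres_def inverse_monoid.simps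
  by (rule UN_equiv_class[OF equiv_icong _ assms])
    (auto intro!: congruentI equiv_class_eq[OF equiv_icong] icong.Inv)

lemmas ipres_simps = ipres_one ipres_mult ipres_minv

lemma inverse_monoid_ipres: "inverse_monoid (ipres G r)"
proof -
  let ?S = "ipres G r"
  interpret monoid ?S
    by (unfold_locales; (elim ipres_carrierE)?;
      simp add: ipres_simps iclass_carrier iclass_eq_iff icong.assoc icong.one_l icong.one_r)
  let ?i = "minv ?S"
  have ic: "?i x \<in> carrier ?S" if "x \<in> carrier ?S" for x
    using that by (elim ipres_carrierE) (simp add: ipres_simps iclass_carrier)
  have l: "x \<otimes>\<^bsub>?S\<^esub> ?i x \<otimes>\<^bsub>?S\<^esub> x = x" if "x \<in> carrier ?S" for x
    using that by (elim ipres_carrierE) (simp add: ipres_simps iclass_eq_iff icong.inv_id)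
  have ii: "?i (?i x) = x" if "x \<in> carrier ?S" for x
    using that by (elim ipres_carrierE) (simp add: ipres_simps iclass_eq_iff icong.inv_inv)
  have im: "?i (x \<otimes>\<^bsub>?S\<^esub> y) = ?i y \<otimes>\<^bsub>?S\<^esub> ?i x" if "x \<in> carrier ?S" "y \<in> carrier ?S" for x y
    using that by (elim ipres_carrierE) (simp add: ipres_simps iclass_eq_iff icong.inv_mul)
  have cm: "(x \<otimes>\<^bsub>?S\<^esub> ?i x) \<otimes>\<^bsub>?S\<^esub> (y \<otimes>\<^bsub>?S\<^esub> ?i y) = (y \<otimes>\<^bsub>?S\<^esub> ?i y) \<otimes>\<^bsub>?S\<^esub> (x \<otimes>\<^bsub>?S\<^esub> ?i x)"
    if "x \<in> carrier ?S" "y \<in> carrier ?S" for x y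
    using that by (elim ipres_carrierE) (simp add: ipres_simps iclass_eq_iff icong.inv_comm)
  have r: "?i x \<otimes>\<^bsub>?S\<^esub> x \<otimes>\<^bsub>?S\<^esub> ?i x = ?i x" if "x \<in> carrier ?S" for x
    using l[OF ic[OF that]] ii[OF that] by simp
  have ei: "e \<otimes>\<^bsub>?S\<^esub> ?i e = e" if e: "e \<in> carrier ?S" "e \<otimes>\<^bsub>?S\<^esub> e = e" for e
  proof -
    have iei: "?i e \<otimes>\<^bsub>?S\<^esub> ?i e = ?i e" using im[OF e(1) e(1)] e(2) by simp
    have "?i e = ?i e \<otimes>\<^bsub>?S\<^esub> (e \<otimes>\<^bsub>?S\<^esub> e) \<otimes>\<^bsub>?S\<^esub> ?i e" using r[OF e(1)] e(2) by simp
    also have "\<dots> = (?i e \<otimes>\<^bsub>?S\<^esub> e) \<otimes>\<^bsub>?S\<^esub> (e \<otimes>\<^bsub>?S\<^esub> ?i e)" using e(1) ic by (simp add: m_assoc)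
    also have "\<dots> = (e \<otimes>\<^bsub>?S\<^esub> ?i e) \<otimes>\<^bsub>?S\<^esub> (?i e \<otimes>\<^bsub>?S\<^esub> e)"
      using cm[OF ic[OF e(1)] e(1)] ii[OF e(1)] by simp
    also have "\<dots> = e \<otimes>\<^bsub>?S\<^esub> (?i e \<otimes>\<^bsub>?S\<^esub> ?i e) \<otimes>\<^bsub>?S\<^esub> e" using e(1) ic by (simp add: m_assoc)
    also have "\<dots> = e" using iei l[OF e(1)] by simp
    finally show ?thesis using e(2) by simp
  qed
  have comm: "e \<otimes>\<^bsub>?S\<^esub> f = f \<otimes>\<^bsub>?S\<^esub> e"
    if "e \<in> carrier ?S" "e \<otimes>\<^bsub>?S\<^esub> e = e" "f \<in> carrier ?S" "f \<otimes>\<^bsub>?S\<^esub> f = f" for e f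
    using cm[of e f] ei[of e] ei[of f] that by simp
  have uniq: "y = z" if c: "x \<in> carrier ?S" "y \<in> carrier ?S" "z \<in> carrier ?S"
    and y: "x \<otimes>\<^bsub>?S\<^esub> y \<otimes>\<^bsub>?S\<^esub> x = x" "y \<otimes>\<^bsub>?S\<^esub> x \<otimes>\<^bsub>?S\<^esub> y = y"
    and z: "x \<otimes>\<^bsub>?S\<^esub> z \<otimes>\<^bsub>?S\<^esub> x = x" "z \<otimes>\<^bsub>?S\<^esub> x \<otimes>\<^bsub>?S\<^esub> z = z" for x y z
  proof -
    have i1: "(y \<otimes>\<^bsub>?S\<^esub> x) \<otimes>\<^bsub>?S\<^esub> (z \<otimes>\<^bsub>?S\<^esub> x) = (z \<otimes>\<^bsub>?S\<^esub> x) \<otimes>\<^bsub>?S\<^esub> (y \<otimes>\<^bsub>?S\<^esub> x)"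
      by (rule comm) (use c y z in \<open>simp_all flip: m_assoc\<close>)
    have i2: "(x \<otimes>\<^bsub>?S\<^esub> y) \<otimes>\<^bsub>?S\<^esub> (x \<otimes>\<^bsub>?S\<^esub> z) = (x \<otimes>\<^bsub>?S\<^esub> z) \<otimes>\<^bsub>?S\<^esub> (x \<otimes>\<^bsub>?S\<^esub> y)"
      by (rule comm) (use c y z in \<open>simp_all flip: m_assoc\<close>)
    have yx: "y \<otimes>\<^bsub>?S\<^esub> x = z \<otimes>\<^bsub>?S\<^esub> x"
    proof -
      have "y \<otimes>\<^bsub>?S\<^esub> x = y \<otimes>\<^bsub>?S\<^esub> (x \<otimes>\<^bsub>?S\<^esub> z \<otimes>\<^bsub>?S\<^esub> x)" using z by simp
      also have "\<dots> = (y \<otimes>\<^bsub>?S\<^esub> x) \<otimes>\<^bsub>?S\<^esub> (z \<otimes>\<^bsub>?S\<^esub> x)" using c by (simp add: m_assoc)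
      also have "\<dots> = z \<otimes>\<^bsub>?S\<^esub> (x \<otimes>\<^bsub>?S\<^esub> y \<otimes>\<^bsub>?S\<^esub> x)" unfolding i1 using c by (simp add: m_assoc)
      finally show ?thesis using y by simp
    qed
    have xy: "x \<otimes>\<^bsub>?S\<^esub> y = x \<otimes>\<^bsub>?S\<^esub> z"
    proof -
      have "x \<otimes>\<^bsub>?S\<^esub> y = (x \<otimes>\<^bsub>?S\<^esub> z \<otimes>\<^bsub>?S\<^esub> x) \<otimes>\<^bsub>?S\<^esub> y" using z by simp
      also have "\<dots> = (x \<otimes>\<^bsub>?S\<^esub> z) \<otimes>\<^bsub>?S\<^esub> (x \<otimes>\<^bsub>?S\<^esub> y)" using c by (simp add: m_assoc)
      also have "\<dots> = (x \<otimes>\<^bsub>?S\<^esub> y \<otimes>\<^bsub>?S\<^esub> x) \<otimes>\<^bsub>?S\<^esub> z"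
        unfolding i2[symmetric] using c by (simp add: m_assoc)
      finally show ?thesis using y by simp
    qed
    have "y = (z \<otimes>\<^bsub>?S\<^esub> x) \<otimes>\<^bsub>?S\<^esub> y" using y yx by simp
    also have "\<dots> = z \<otimes>\<^bsub>?S\<^esub> (x \<otimes>\<^bsub>?S\<^esub> z)" using c xy by (simp add: m_assoc)
    finally show ?thesis using c z by (simp add: m_assoc)
  qed
  show ?thesis
  proof
    fix x y assume "x \<in> carrier ?S" "y \<in> carrier ?S"
      "x \<otimes>\<^bsub>?S\<^esub> y \<otimes>\<^bsub>?S\<^esub> x = x" "y \<otimes>\<^bsub>?S\<^esub> x \<otimes>\<^bsub>?S\<^esub> y = y"
    then show "y = ?i x" by - (rule uniq[of x], simp_all add: ic l r)
  qed (simp_all add: ic l r)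
qed

primrec ieval :: "('a, 'c) inverse_monoid_scheme \<Rightarrow> ('g \<Rightarrow> 'a) \<Rightarrow> 'g iterm \<Rightarrow> 'a" where
  "ieval S g (IGen x) = g x"
| "ieval S g IOne = \<one>\<^bsub>S\<^esub>"
| "ieval S g (IMul s t) = ieval S g s \<otimes>\<^bsub>S\<^esub> ieval S g t"
| "ieval S g (IInv t) = minv S (ieval S g t)"

lemma ieval_closed:
  assumes "inverse_monoid S" "g \<in> G \<rightarrow> carrier S" "t \<in> iterms G"
  shows "ieval S g t \<in> carrier S"
proof -
  interpret inverse_monoid S by fact
  show ?thesis using assms(3)
    by (induction t) (use assms(2) in \<open>auto intro: minv_closed\<close>)
qed

theorem ieval_sound:
  assumes S: "inverse_monoid S" and g: "g \<in> G \<rightarrow> carrier S"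
    and r: "\<And>s t. (s, t) \<in> r \<Longrightarrow> ieval S g s = ieval S g t"
    and st: "(s, t) \<in> icong G r"
  shows "ieval S g s = ieval S g t"
proof -
  interpret inverse_monoid S by fact
  note c = ieval_closed[OF S g]
  show ?thesis using st
  proof (induction rule: icong.induct)
    case (rel s t) then show ?case using r by blast
  next
    case (inv_comm x y)
    then show ?case using c by (simp add: idem_comm idem_r minv_closed)
  qed (simp_all only: ieval.simps,
      (rule m_assoc l_one r_one minv_left minv_minv minv_mult; intro c CollectI; assumption)+)
qed

subsection \<open>Basic properties of \<open>FR\<^sub>R(M)\<close>, \<open>FI\<^sub>R(M)\<close> and \<open>psi\<close>\<close>

lemma restriction_monoid_FR: "restriction_monoid (FR M X R)"
  unfolding FR_def by (rule restriction_monoid_rpres)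

lemma inverse_monoid_FI: "inverse_monoid (FI M X R)"
  unfolding FI_def by (rule inverse_monoid_ipres)

lemma restriction_monoid_FI: "restriction_monoid (restriction_of (FI M X R))"
  by (rule inverse_monoid.restriction_monoid_restriction_of[OF inverse_monoid_FI])

lemma to_iterm_terms: "t \<in> rterms G \<Longrightarrow> to_iterm t \<in> iterms G"
  by (induction t) auto

lemma FI_gen_closed: "m \<in> carrier M \<Longrightarrow> FI_gen M X R m \<in> carrier (restriction_of (FI M X R))"
  by (simp add: restriction_of_def FI_def FI_gen_def iclass_carrier)

lemma reval_FI:
  assumes "t \<in> rterms (carrier M)"
  shows "reval (restriction_of (FI M X R)) (FI_gen M X R) t =
    icong (carrier M) (FI_rels M X R) `` {to_iterm t}"
  using assms
  by (induction t)
    (auto simp: restriction_of_def FI_def FI_gen_def ipres_simps to_iterm_terms[unfolded mem_Collect_eq])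

lemma FR_rels_terms:
  assumes M: "monoid M" and R: "\<And>pq. pq \<in> R \<Longrightarrow> identity_over X pq" and st: "(s, t) \<in> FR_rels M X R"
  shows "s \<in> rterms (carrier M) \<and> t \<in> rterms (carrier M)"
proof -
  interpret monoid M by fact
  have m: "map_rterm (word_ext M f) a \<in> rterms (carrier M)"
    if "f \<in> X \<rightarrow> carrier M" "a \<in> rterms (lists X)" for f a
    using word_ext_closed[OF M that(1)] that(2) by (auto simp: rterm.set_map)
  have c: "a \<in> rterms (lists X) \<and> b \<in> rterms (lists X)" if "(p, q) \<in> R" "a \<in> p" "b \<in> q" for p q a b
  proof -
    have "identity_over X (p, q)" using R[OF that(1)] .
    then obtain a' b' where "p = rcong (lists X) {} `` {a'}" "q = rcong (lists X) {} `` {b'}"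
      by (rule identity_overE)
    then have "(a', a) \<in> rcong (lists X) {}" "(b', b) \<in> rcong (lists X) {}" using that by auto
    then show ?thesis using rcong_terms by metis
  qed
  from st consider "s = Gen \<one>\<^bsub>M\<^esub>" "t = One"
    | m n where "m \<in> carrier M" "n \<in> carrier M" "s = Mul (Gen m) (Gen n)"
        "t = Mul (Gen (m \<otimes>\<^bsub>M\<^esub> n)) (Star (Mul (Gen m) (Gen n)))"
    | p q f a b where "(p, q) \<in> R" "f \<in> X \<rightarrow> carrier M" "a \<in> p" "b \<in> q"
        "s = map_rterm (word_ext M f) a" "t = map_rterm (word_ext M f) b"
    unfolding FR_rels_def by blast
  then show ?thesis
  proof cases
    case 3
    then show ?thesis using m c by metis
  qed simp_all
qed

lemma reval_FI_rels:
  assumes M: "monoid M" and R: "\<And>pq. pq \<in> R \<Longrightarrow> identity_over X pq" and st: "(s, t) \<in> FR_rels M X R"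
  shows "reval (restriction_of (FI M X R)) (FI_gen M X R) s =
    reval (restriction_of (FI M X R)) (FI_gen M X R) t"
proof -
  have c: "s \<in> rterms (carrier M)" "t \<in> rterms (carrier M)" using FR_rels_terms[OF assms] by auto
  have "(to_iterm s, to_iterm t) \<in> icong (carrier M) (FI_rels M X R)"
    using st c by (intro icong.rel) (auto simp: FI_rels_def to_iterm_terms[unfolded mem_Collect_eq])
  then show ?thesis using reval_FI c equiv_class_eq[OF equiv_icong] by metis
qed

theorem psi_hom:
  assumes M: "monoid M" and R: "\<And>pq. pq \<in> R \<Longrightarrow> identity_over X pq"
  shows "psi M X R \<in> restriction_hom (FR M X R) (restriction_of (FI M X R))"
    and "m \<in> carrier M \<Longrightarrow> psi M X R (FR_gen M X R m) = FI_gen M X R m"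
proof -
  have g: "FI_gen M X R \<in> carrier M \<rightarrow> carrier (restriction_of (FI M X R))"
    by (rule Pi_I) (rule FI_gen_closed)
  note h = rlift_hom[OF restriction_monoid_FI g reval_FI_rels[OF assms]]
  show "psi M X R \<in> restriction_hom (FR M X R) (restriction_of (FI M X R))"
    unfolding psi_def FR_def by (rule h(1))
  show "m \<in> carrier M \<Longrightarrow> psi M X R (FR_gen M X R m) = FI_gen M X R m"
    unfolding psi_def FR_gen_def by (rule h(2))
qed

lemma reval_map: "reval S g (map_rterm h t) = reval S (\<lambda>u. g (h u)) t"
  by (induction t) auto

lemma reval_FR:
  assumes "t \<in> rterms (carrier M)"
  shows "reval (FR M X R) (FR_gen M X R) t = rcong (carrier M) (FR_rels M X R) `` {t}"
  using assms by (induction t) (auto simp: FR_def FR_gen_def rpres_simps)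

theorem FR_gen_satisfies:
  assumes M: "monoid M" and R: "\<And>pq. pq \<in> R \<Longrightarrow> identity_over X pq" and pq: "pq \<in> R"
  shows "satisfies X M (FR M X R) (FR_gen M X R) pq"
    and "satisfies X M (restriction_of (FI M X R)) (FI_gen M X R) pq"
proof -
  obtain p q where [simp]: "pq = (p, q)" by (cases pq)
  obtain s t where st: "s \<in> rterms (lists X)" "t \<in> rterms (lists X)"
    "p = rcong (lists X) {} `` {s}" "q = rcong (lists X) {} `` {t}"
    using R[OF pq] by (auto elim: identity_overE)
  have g: "FI_gen M X R \<in> carrier M \<rightarrow> carrier (restriction_of (FI M X R))"
    by (rule Pi_I) (rule FI_gen_closed)
  have g': "FR_gen M X R \<in> carrier M \<rightarrow> carrier (FR M X R)"
    by (auto simp: FR_def FR_gen_def intro!: rclass_carrier)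
  have rel: "(map_rterm (word_ext M f) s, map_rterm (word_ext M f) t) \<in> FR_rels M X R"
    if "f \<in> X \<rightarrow> carrier M" for f
  proof -
    have "s \<in> p" "t \<in> q" using st by (auto intro: rcong.refl)
    then show ?thesis using that pq unfolding FR_rels_def by auto
  qed
  show "satisfies X M (restriction_of (FI M X R)) (FI_gen M X R) pq"
    unfolding satisfies_def
  proof clarsimp
    fix f assume f: "f \<in> X \<rightarrow> carrier M"
    show "ident_value M (restriction_of (FI M X R)) (FI_gen M X R) f p =
        ident_value M (restriction_of (FI M X R)) (FI_gen M X R) f q"
      using reval_FI_rels[OF M R rel[OF f]] ident_value_class[OF M restriction_monoid_FI g f] st
      by (simp add: reval_map)
  qed
  show "satisfies X M (FR M X R) (FR_gen M X R) pq"
    unfolding satisfies_def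
  proof clarsimp
    fix f assume f: "f \<in> X \<rightarrow> carrier M"
    have c: "map_rterm (word_ext M f) s \<in> rterms (carrier M)" "map_rterm (word_ext M f) t \<in> rterms (carrier M)"
      using FR_rels_terms[OF M R rel[OF f]] by auto
    have "reval (FR M X R) (FR_gen M X R) (map_rterm (word_ext M f) s) =
        reval (FR M X R) (FR_gen M X R) (map_rterm (word_ext M f) t)"
      unfolding reval_FR[OF c(1)] reval_FR[OF c(2)]
      by (rule equiv_class_eq[OF equiv_rcong]) (use rcong.rel[OF rel[OF f]] c in simp)
    then show "ident_value M (FR M X R) (FR_gen M X R) f p = ident_value M (FR M X R) (FR_gen M X R) f q"
      using ident_value_class[OF M restriction_monoid_FR g' f] st by (simp add: reval_map)
  qed
qed

end

theory Submission
  imports Defs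
begin

text \<open>A restriction monoid \<open>S\<close> acts on its projections by partial bijections: \<open>s\<close> relates
  \<open>e \<le> s\<^sup>+\<close> to \<open>(es)\<^sup>* \<le> s\<^sup>*\<close>, the Munn representation. This is a morphism of restriction monoids into
  the symmetric inverse monoid on the projections. For \<open>S = FR\<^sub>R(M)\<close> the images of the generators thus
  satisfy the defining relations of \<open>FI\<^sub>R(M)\<close>, so \<open>FI\<^sub>R(M)\<close> acts on \<open>P(FR\<^sub>R(M))\<close> as well. The range of
  the action of a word \<open>u\<close> is the principal ideal below \<open>D\<^sub>u\<close>, hence \<open>D\<^sub>u\<close> only depends on the value of
  \<open>u\<close>; and as a projection \<open>p\<close> acts as the identity of the ideal below \<open>p\<close>, we have
  \<open>D\<^bsub>\<psi>(p)\<^esub> = p\<close>. Conversely \<open>\<psi>(D\<^sub>u) = u\<^sup>-\<^sup>1u\<close> by induction on \<open>u\<close>, which is \<open>u\<close> if \<open>u\<close> is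
  idempotent.\<close>

section \<open>Projections of a restriction monoid\<close>

context restriction_monoid
begin

lemma projection_closed: "e \<in> projections S \<Longrightarrow> e \<in> carrier S"
  by (auto simp: projections_def rstar_closed)

lemma rstar_projection: "x \<in> carrier S \<Longrightarrow> rstar S x \<in> projections S"
  by (simp add: projections_def)

lemma rplus_projection: "x \<in> carrier S \<Longrightarrow> rplus S x \<in> projections S"
  by (simp add: projections_eq_plus)

lemma projection_star: "e \<in> projections S \<Longrightarrow> rstar S e = e"
  using star_plus by (auto simp: projections_eq_plus)

lemma projection_plus: "e \<in> projections S \<Longrightarrow> rplus S e = e"
  using plus_star by (auto simp: projections_def)

lemma projection_idem: "e \<in> projections S \<Longrightarrow> e \<otimes> e = e"
  using star_id[of e] by (simp add: projection_star projection_closed)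

lemma projection_comm: "e \<in> projections S \<Longrightarrow> f \<in> projections S \<Longrightarrow> e \<otimes> f = f \<otimes> e"
  using star_comm[of e f] by (simp add: projection_star projection_closed)

lemma projection_mult:
  assumes "e \<in> projections S" "f \<in> projections S"
  shows "e \<otimes> f \<in> projections S"
proof -
  have "e \<otimes> f = rstar S (e \<otimes> f)"
    using star_star[of e f] assms by (simp add: projection_star projection_closed)
  then show ?thesis using rstar_projection assms projection_closed by (metis m_closed)
qed

lemma one_projection: "\<one> \<in> projections S"
  using plus_id[of \<one>] rplus_projection[of \<one>] rplus_closed[of \<one>] by simp

lemma projection_mult_plus:
  "e \<in> projections S \<Longrightarrow> x \<in> carrier S \<Longrightarrow> rplus S (e \<otimes> x) = e \<otimes> rplus S x"
  using plus_plus[of e x] by (simp add: projection_plus projection_closed)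

lemma mult_projection_star:
  "e \<in> projections S \<Longrightarrow> x \<in> carrier S \<Longrightarrow> rstar S (x \<otimes> e) = rstar S x \<otimes> e"
  using star_star[of x e] by (simp add: projection_star projection_closed)

lemma projection_mult_ample:
  "e \<in> projections S \<Longrightarrow> x \<in> carrier S \<Longrightarrow> e \<otimes> x = x \<otimes> rstar S (e \<otimes> x)"
  using star_ample[of e x] by (simp add: projection_star projection_closed)

lemma mult_projection_ample:
  "e \<in> projections S \<Longrightarrow> x \<in> carrier S \<Longrightarrow> x \<otimes> e = rplus S (x \<otimes> e) \<otimes> x"
  using plus_ample[of x e] by (simp add: projection_plus projection_closed)

section \<open>Order and principal ideals in the semilattice of projections\<close>

lemma rplus_mult_le:
  assumes "x \<in> carrier S" "y \<in> carrier S"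
  shows "rplus S (x \<otimes> y) \<otimes> rplus S x = rplus S (x \<otimes> y)"
proof -
  \<comment> \<open>As x = x^+ x, the factor x^+ can be inserted in front and then pulled out by
    \<open>plus_plus\<close>.\<close>
  have "rplus S (x \<otimes> y) = rplus S (rplus S x \<otimes> (x \<otimes> y))"
    using assms by (simp add: plus_id rplus_closed flip: m_assoc)
  also have "\<dots> = rplus S x \<otimes> rplus S (x \<otimes> y)" using assms by (simp add: plus_plus)
  finally show ?thesis using assms by (simp add: plus_comm)
qed

lemma rstar_mult_le:
  assumes "x \<in> carrier S" "y \<in> carrier S"
  shows "rstar S (x \<otimes> y) \<otimes> rstar S y = rstar S (x \<otimes> y)"
proof -
  have "rstar S (x \<otimes> y) = rstar S ((x \<otimes> y) \<otimes> rstar S y)"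
    using assms by (simp add: star_id rstar_closed m_assoc)
  then show ?thesis using assms by (simp add: star_star)
qed

text \<open>The principal ideal of d in the natural order, where e \<le> d means ed = e. Such ideals
  are the domains, ranges and images that occur for the partial bijections below.\<close>

definition below :: "'a \<Rightarrow> 'a set" where
  "below d = {e \<in> projections S. e \<otimes> d = e}"

lemma below_mono:
  assumes "e \<in> below d" "d \<in> below c" "c \<in> carrier S"
  shows "e \<in> below c"
  using assms projection_closed m_assoc[of e d c] by (auto simp: below_def)

lemma belowI: "e \<in> projections S \<Longrightarrow> d \<in> projections S \<Longrightarrow> d \<otimes> e = e \<Longrightarrow> e \<in> below d"
  using projection_comm[of d e] by (simp add: below_def)

text \<open>Antisymmetry of the order: each generator lies in the other ideal. This recovers D_u
  from the range of the action of u.\<close>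

lemma below_inject:
  assumes "c \<in> projections S" "d \<in> projections S" "below c = below d"
  shows "c = d"
proof -
  have "c \<in> below d" "d \<in> below c" using assms projection_idem by (auto simp: below_def)
  then show ?thesis using projection_comm[OF assms(1,2)] by (simp add: below_def)
qed

lemma below_one: "below \<one> = projections S"
  using projection_closed by (auto simp: below_def)

lemma rplus_mult_below: "x \<in> carrier S \<Longrightarrow> y \<in> carrier S \<Longrightarrow> rplus S (x \<otimes> y) \<in> below (rplus S x)"
  by (simp add: below_def rplus_projection rplus_mult_le)

lemma rstar_mult_below: "x \<in> carrier S \<Longrightarrow> y \<in> carrier S \<Longrightarrow> rstar S (x \<otimes> y) \<in> below (rstar S y)"
  by (simp add: below_def rstar_projection rstar_mult_le)

section \<open>The Munn representation\<close>

text \<open>Under the two bounds, the equation is equivalent to f = (es)^* and also to e = (sf)^+ ,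
  so this form treats both directions of the partial bijection alike.\<close>

definition munn :: "'a \<Rightarrow> 'a rel" where
  "munn s = {(e, f). e \<in> below (rplus S s) \<and> f \<in> below (rstar S s) \<and> e \<otimes> s = s \<otimes> f}"

text \<open>Applying ^* to es = sf turns the right side into s^* f, which is f because f \<le> s^*
  .\<close>

lemma munn_eq_star:
  assumes "s \<in> carrier S" "(e, f) \<in> munn s"
  shows "f = rstar S (e \<otimes> s)"
  using assms mult_projection_star[of f s] projection_comm[OF rstar_projection[OF assms(1)], of f]
  by (simp add: munn_def below_def)

lemma munn_eq_plus:
  assumes "s \<in> carrier S" "(e, f) \<in> munn s"
  shows "e = rplus S (s \<otimes> f)"
  using assms projection_mult_plus[of e s] by (simp add: munn_def below_def)

text \<open>The ample law gives es = s(es)^* , and (es)^* \<le> s^* holds as well.\<close>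

lemma munn_star:
  assumes s: "s \<in> carrier S" and e: "e \<in> below (rplus S s)"
  shows "(e, rstar S (e \<otimes> s)) \<in> munn s"
proof -
  have "e \<in> projections S" using e by (simp add: below_def)
  then show ?thesis
    using assms rstar_mult_below[OF projection_closed] projection_mult_ample
    unfolding munn_def by blast
qed

lemma munn_plus:
  assumes s: "s \<in> carrier S" and f: "f \<in> below (rstar S s)"
  shows "(rplus S (s \<otimes> f), f) \<in> munn s"
proof -
  have "f \<in> projections S" using f by (simp add: below_def)
  then show ?thesis
    using assms rplus_mult_below[OF _ projection_closed] mult_projection_ample[symmetric]
    unfolding munn_def by blast
qed

lemma munn_subset: "munn s \<subseteq> projections S \<times> projections S"
  by (auto simp: munn_def below_def)

lemma munn_single_valued: "s \<in> carrier S \<Longrightarrow> single_valued (munn s)"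
  by (rule single_valuedI) (metis munn_eq_star)

lemma munn_converse_single_valued: "s \<in> carrier S \<Longrightarrow> single_valued ((munn s)\<inverse>)"
  by (rule single_valuedI) (metis munn_eq_plus converse_iff)

lemma Domain_munn: "s \<in> carrier S \<Longrightarrow> Domain (munn s) = below (rplus S s)"
  using munn_star by (auto simp: munn_def)

lemma Range_munn: "s \<in> carrier S \<Longrightarrow> Range (munn s) = below (rstar S s)"
  using munn_plus by (auto simp: munn_def)

text \<open>Both bounding ideals are that of p, and there ep = e and pf = f, so the defining
  equation reads e = f.\<close>

lemma munn_projection:
  assumes "p \<in> projections S"
  shows "munn p = Id_on (below p)"
proof -
  have "e \<otimes> p = p \<otimes> f \<longleftrightarrow> e = f" if "e \<in> below p" "f \<in> below p" for e f
    using that projection_comm[OF assms, of f] by (simp add: below_def)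
  then show ?thesis
    by (auto simp: munn_def projection_star[OF assms] projection_plus[OF assms])
qed

lemma munn_one: "munn \<one> = Id_on (projections S)"
  using munn_projection[OF one_projection] by (simp add: below_one)

text \<open>The equations compose by associativity. The work lies in the bounds e \<le> (st)^+ and g
  \<le> (st)^* in one direction and in the intermediate point in the other.\<close>

lemma munn_mult:
  assumes s: "s \<in> carrier S" and t: "t \<in> carrier S"
  shows "munn (s \<otimes> t) = munn s O munn t"
proof (intro equalityI subrelI)
  fix e g assume "(e, g) \<in> munn s O munn t"
  then obtain f where f: "(e, f) \<in> munn s" "(f, g) \<in> munn t" by auto
  have P: "e \<in> projections S" "f \<in> projections S" "g \<in> projections S"
    using f munn_subset by auto
  note c = P[THEN projection_closed]
  have es: "e \<otimes> s = s \<otimes> f" and ft: "f \<otimes> t = t \<otimes> g" using f by (auto simp: munn_def)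
  have eq: "e \<otimes> (s \<otimes> t) = s \<otimes> t \<otimes> g"
    using es ft s t c by (metis m_assoc)
  have e: "e \<otimes> rplus S (s \<otimes> t) = e"
  proof -
    have "f \<otimes> rplus S t = f" using f by (simp add: munn_def below_def)
    \<comment> \<open>Since f \<le> t^+ , this factor can be inserted into e = (sf)^+ . Once sf is
      replaced by es, the ample law moves t^+ to the left past s, where it becomes (st)^+ .\<close>
    then have "e = rplus S (s \<otimes> f \<otimes> rplus S t)"
      using munn_eq_plus[OF s f(1)] s t c m_assoc by (simp add: rplus_closed)
    also have "\<dots> = rplus S (e \<otimes> (s \<otimes> rplus S t))"
      using s t c by (simp add: es[symmetric] m_assoc rplus_closed)
    also have "\<dots> = rplus S (e \<otimes> (rplus S (s \<otimes> t) \<otimes> s))" using s t by (simp add: plus_ample)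
    also have "\<dots> = e \<otimes> (rplus S (s \<otimes> t) \<otimes> rplus S s)"
      using s t c P by (simp add: projection_mult_plus plus_plus rplus_closed)
    finally have "e = e \<otimes> (rplus S (s \<otimes> t) \<otimes> rplus S s)" .
    then show ?thesis using rplus_mult_le[OF s t] by simp
  qed
  have g: "g \<otimes> rstar S (s \<otimes> t) = g"
  proof -
    have sf: "rstar S s \<otimes> f = f"
      using f(1) projection_comm[OF rstar_projection[OF s] P(2)] by (simp add: munn_def below_def)
    \<comment> \<open>Dually, s^* is inserted in front of f and moves to the right past t as (st)^*
      .\<close>
    have "g = rstar S (rstar S s \<otimes> f \<otimes> t)"
      using munn_eq_star[OF t f(2)] sf by simp
    also have "\<dots> = rstar S (rstar S s \<otimes> t \<otimes> g)"
      using s t c ft by (simp add: m_assoc rstar_closed)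
    also have "\<dots> = rstar S (t \<otimes> rstar S (s \<otimes> t) \<otimes> g)" using s t by (simp add: star_ample)
    also have "\<dots> = rstar S t \<otimes> rstar S (s \<otimes> t) \<otimes> g"
      using s t c P by (simp add: mult_projection_star star_star rstar_closed)
    also have "\<dots> = rstar S (s \<otimes> t) \<otimes> g"
      using star_comm[OF t, of "s \<otimes> t"] rstar_mult_le[OF s t] s t by simp
    also have "\<dots> = g \<otimes> rstar S (s \<otimes> t)"
      by (rule projection_comm) (use s t P rstar_projection in auto)
    finally show ?thesis ..
  qed
  show "(e, g) \<in> munn (s \<otimes> t)"
    using P eq e g by (simp add: munn_def below_def)
next
  fix e g assume eg: "(e, g) \<in> munn (s \<otimes> t)"
  have P: "e \<in> projections S" "g \<in> projections S" using eg munn_subset by auto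
  note c = P[THEN projection_closed]
  \<comment> \<open>By \<open>munn_eq_star\<close> this is the only candidate for the point between
    e and g.\<close>
  define f where "f = rstar S (e \<otimes> s)"
  have fP: "f \<in> projections S" using s c by (simp add: f_def rstar_projection)
  have e: "e \<in> below (rplus S (s \<otimes> t))" and g: "g \<in> below (rstar S (s \<otimes> t))"
    and eq: "e \<otimes> (s \<otimes> t) = s \<otimes> t \<otimes> g" using eg by (auto simp: munn_def)
  have "(e, f) \<in> munn s"
    unfolding f_def using munn_star below_mono[OF e rplus_mult_below] s t by (simp add: rplus_closed)
  moreover have "(f, g) \<in> munn t"
  proof -
    \<comment> \<open>The bound e \<le> (st)^+ passes to f \<le> t^+ through the ample law s t^+ =
      (st)^+ s.\<close>
    have "e \<otimes> s \<otimes> rplus S t = e \<otimes> rplus S (s \<otimes> t) \<otimes> s"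
      using s t c by (simp add: m_assoc plus_ample rplus_closed)
    also have "\<dots> = e \<otimes> s" using e by (simp add: below_def)
    finally have "e \<otimes> s \<otimes> rplus S t = e \<otimes> s" .
    then have "f \<otimes> rplus S t = f"
      using mult_projection_star[OF rplus_projection[OF t], of "e \<otimes> s"] s c by (simp add: f_def)
    moreover have "f \<otimes> t = t \<otimes> g"
    proof -
      have "f \<otimes> t = t \<otimes> rstar S (e \<otimes> (s \<otimes> t))" using s t c by (simp add: f_def star_ample m_assoc)
      then show ?thesis using munn_eq_star[OF _ eg] s t by simp
    qed
    moreover have "g \<in> below (rstar S t)"
      using below_mono[OF g rstar_mult_below] s t by (simp add: rstar_closed)
    ultimately show ?thesis using fP by (simp add: munn_def below_def)
  qed
  ultimately show "(e, g) \<in> munn s O munn t" by auto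
qed

text \<open>With s a generator, this and the version for the converse are the two clauses of
  \<open>D_step\<close>, read on ideals in place of projections.\<close>

lemma munn_Image_below:
  assumes s: "s \<in> carrier S" and d: "d \<in> projections S"
  shows "munn s `` below d = below (rstar S (d \<otimes> s))"
proof (intro equalityI subsetI)
  fix f assume "f \<in> munn s `` below d"
  then obtain e where e: "(e, f) \<in> munn s" "e \<in> below d" by auto
  have c: "e \<in> carrier S" "d \<in> carrier S" using e d projection_closed by (auto simp: below_def)
  have "f = rstar S (e \<otimes> (d \<otimes> s))"
    using munn_eq_star[OF s e(1)] e(2) c s by (simp add: below_def flip: m_assoc)
  then show "f \<in> below (rstar S (d \<otimes> s))" using rstar_mult_below s c by simp
next
  fix f assume f: "f \<in> below (rstar S (d \<otimes> s))"
  then have fP: "f \<in> projections S" by (simp add: below_def)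
  note c = projection_closed[OF d] projection_closed[OF fP]
  have "f \<in> below (rstar S s)" using below_mono[OF f rstar_mult_below] s c by (simp add: rstar_closed)
  then have m: "(rplus S (s \<otimes> f), f) \<in> munn s" by (rule munn_plus[OF s])
  \<comment> \<open>It remains to see that the preimage (sf)^+ lies below d, which follows from sf =
    s(ds)^* f = d(sf).\<close>
  have "f = rstar S (d \<otimes> s) \<otimes> f"
    using f projection_comm[OF rstar_projection fP] s c by (simp add: below_def)
  then have "s \<otimes> f = s \<otimes> rstar S (d \<otimes> s) \<otimes> f" using s c m_assoc by (simp add: rstar_closed)
  also have "\<dots> = d \<otimes> (s \<otimes> f)" using projection_mult_ample[OF d s] s c m_assoc by simp
  finally have "d \<otimes> rplus S (s \<otimes> f) = rplus S (s \<otimes> f)"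
    using projection_mult_plus[OF d, of "s \<otimes> f"] s c by simp
  then have "rplus S (s \<otimes> f) \<in> below d" using belowI[OF rplus_projection d] s c by simp
  then show "f \<in> munn s `` below d" using m by auto
qed

lemma munn_converse_Image_below:
  assumes s: "s \<in> carrier S" and d: "d \<in> projections S"
  shows "(munn s)\<inverse> `` below d = below (rplus S (s \<otimes> d))"
proof (intro equalityI subsetI)
  fix e assume "e \<in> (munn s)\<inverse> `` below d"
  then obtain f where f: "(e, f) \<in> munn s" "f \<in> below d" by auto
  have c: "f \<in> carrier S" "d \<in> carrier S" using f d projection_closed by (auto simp: below_def)
  have "d \<otimes> f = f" using f(2) d projection_comm[OF d] by (simp add: below_def)
  then have "e = rplus S (s \<otimes> d \<otimes> f)"
    using munn_eq_plus[OF s f(1)] c s by (simp add: m_assoc)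
  then show "e \<in> below (rplus S (s \<otimes> d))" using rplus_mult_below s c by simp
next
  fix e assume e: "e \<in> below (rplus S (s \<otimes> d))"
  then have eP: "e \<in> projections S" by (simp add: below_def)
  note c = projection_closed[OF d] projection_closed[OF eP]
  have "e \<in> below (rplus S s)" using below_mono[OF e rplus_mult_below] s c by (simp add: rplus_closed)
  then have m: "(e, rstar S (e \<otimes> s)) \<in> munn s" by (rule munn_star[OF s])
  have "e \<otimes> s = e \<otimes> rplus S (s \<otimes> d) \<otimes> s" using e by (simp add: below_def)
  also have "\<dots> = e \<otimes> s \<otimes> d"
    using mult_projection_ample[OF d s] s c m_assoc by (simp add: rplus_closed)
  finally have "rstar S (e \<otimes> s) = rstar S (e \<otimes> s) \<otimes> d"
    using mult_projection_star[OF d, of "e \<otimes> s"] s c by simp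
  then have "rstar S (e \<otimes> s) \<in> below d" using rstar_projection s c by (simp add: below_def)
  then show "e \<in> (munn s)\<inverse> `` below d" using m by auto
qed

end

section \<open>The symmetric inverse monoid\<close>

text \<open>Partial bijections are relations that are single-valued in both directions. As
  \<open>O\<close> applies its left factor first, elements act from the right, so
  \<open>munn\<close> preserves products rather than reversing them.\<close>

definition symmetric_inverse_monoid :: "'a set \<Rightarrow> 'a rel inverse_monoid" where
  "symmetric_inverse_monoid A = \<lparr>carrier = {r. r \<subseteq> A \<times> A \<and> single_valued r \<and> single_valued (r\<inverse>)},
     mult = (O), one = Id_on A, minv = converse\<rparr>"

lemma single_valued_converse_comp:
  "single_valued r \<Longrightarrow> r\<inverse> O r = Id_on (Range r)"
  by (auto simp: single_valued_def)

lemma comp_converse_comp: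
  assumes "single_valued r"
  shows "r O r\<inverse> O r = r"
  unfolding single_valued_converse_comp[OF assms] by auto

lemma inverse_monoid_symmetric: "inverse_monoid (symmetric_inverse_monoid A)"
proof
  fix x y assume "x \<in> carrier (symmetric_inverse_monoid A)" "y \<in> carrier (symmetric_inverse_monoid A)"
    "x \<otimes>\<^bsub>symmetric_inverse_monoid A\<^esub> y \<otimes>\<^bsub>symmetric_inverse_monoid A\<^esub> x = x"
    "y \<otimes>\<^bsub>symmetric_inverse_monoid A\<^esub> x \<otimes>\<^bsub>symmetric_inverse_monoid A\<^esub> y = y"
  then have sv: "single_valued x" "single_valued (x\<inverse>)" "single_valued y" "single_valued (y\<inverse>)"
    and xyx: "x O y O x = x" and yxy: "y O x O y = y"
    by (auto simp: symmetric_inverse_monoid_def O_assoc)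
  \<comment> \<open>Uniqueness of inverses: a pair (b, a) of v factors through v, w, v, and
    single-valuedness in both directions forces the middle pair to be (a, b). The cases v = x and v
    = y give the two inclusions.\<close>
  have "v\<inverse> \<subseteq> w" if "v O w O v = v" "single_valued v" "single_valued (v\<inverse>)" for v w :: "'a rel"
  proof (rule subrelI)
    fix a b assume "(a, b) \<in> v\<inverse>"
    then have ba: "(b, a) \<in> v" by simp
    then have "(b, a) \<in> v O w O v" using that(1) by simp
    then obtain a' b' where "(b, a') \<in> v" "(a', b') \<in> w" "(b', a) \<in> v" by blast
    moreover have "a' = a" "b' = b"
      using calculation ba single_valuedD[OF that(2)] single_valuedD[OF that(3)] by blast+
    ultimately show "(a, b) \<in> w" by simp
  qed
  from this[OF xyx sv(1,2)] this[OF yxy sv(3,4)]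
  have "y = x\<inverse>" by auto
  then show "y = minv (symmetric_inverse_monoid A) x" by (simp add: symmetric_inverse_monoid_def)
next
  fix x y assume "x \<in> carrier (symmetric_inverse_monoid A)" "y \<in> carrier (symmetric_inverse_monoid A)"
  then show "x \<otimes>\<^bsub>symmetric_inverse_monoid A\<^esub> y \<in> carrier (symmetric_inverse_monoid A)"
    by (auto simp: symmetric_inverse_monoid_def converse_relcomp intro: single_valued_relcomp)
next
  fix x assume "x \<in> carrier (symmetric_inverse_monoid A)"
  then show "x \<otimes>\<^bsub>symmetric_inverse_monoid A\<^esub> minv (symmetric_inverse_monoid A) x
      \<otimes>\<^bsub>symmetric_inverse_monoid A\<^esub> x = x"
    and "minv (symmetric_inverse_monoid A) x \<otimes>\<^bsub>symmetric_inverse_monoid A\<^esub> x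
      \<otimes>\<^bsub>symmetric_inverse_monoid A\<^esub> minv (symmetric_inverse_monoid A) x
    = minv (symmetric_inverse_monoid A) x"
    using comp_converse_comp[of x] comp_converse_comp[of "x\<inverse>"]
    by (simp_all add: symmetric_inverse_monoid_def O_assoc)
qed (auto simp: symmetric_inverse_monoid_def single_valued_def)

text \<open>For a partial bijection r, the product of its converse and r is the identity on its
  range. The range of \<open>munn s\<close> is the ideal of s^* , on which s^* itself acts as the
  identity; dually for s^+ and the domain.\<close>

theorem (in restriction_monoid) munn_hom:
  "munn \<in> restriction_hom S (restriction_of (symmetric_inverse_monoid (projections S)))"
proof -
  have "munn (rstar S s) = (munn s)\<inverse> O munn s" if "s \<in> carrier S" for s
    using that single_valued_converse_comp[OF munn_single_valued[OF that]]
    by (simp add: Range_munn munn_projection rstar_projection)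
  moreover have "munn (rplus S s) = munn s O (munn s)\<inverse>" if "s \<in> carrier S" for s
    using that single_valued_converse_comp[OF munn_converse_single_valued[OF that]]
    by (simp add: Domain_munn munn_projection rplus_projection)
  ultimately show ?thesis
    using munn_subset munn_single_valued munn_converse_single_valued munn_one munn_mult
    by (simp add: restriction_hom_def hom_def restriction_of_def symmetric_inverse_monoid_def Pi_iff)
qed

section \<open>Evaluation of terms and words\<close>

lemma reval_hom:
  assumes S: "restriction_monoid S" and h: "h \<in> restriction_hom S T"
    and g: "g \<in> G \<rightarrow> carrier S" and t: "t \<in> rterms G"
  shows "h (reval S g t) = reval T (\<lambda>x. h (g x)) t"
  using t
proof (induction t)
  case (Mul s t)
  then have "s \<in> rterms G" "t \<in> rterms G" by auto
  then show ?case using Mul.IH h reval_closed[OF S g] by (simp add: restriction_hom_def hom_def)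
next
  case (Star t)
  then have "t \<in> rterms G" by auto
  then show ?case using Star.IH h reval_closed[OF S g] by (simp add: restriction_hom_def)
next
  case (Plus t)
  then have "t \<in> rterms G" by auto
  then show ?case using Plus.IH h reval_closed[OF S g] by (simp add: restriction_hom_def)
qed (use h in \<open>auto simp: restriction_hom_def\<close>)

lemma ieval_to_iterm: "ieval S g (to_iterm t) = reval (restriction_of S) g t"
  by (induction t) (simp_all add: restriction_of_def)

primrec letter_term :: "'m letter \<Rightarrow> 'm iterm" where
  "letter_term (Pos m) = IGen m"
| "letter_term (Neg m) = IInv (IGen m)"

text \<open>The action and the defining congruence live on terms whereas D is defined on words;
  these representatives connect the two.\<close>

primrec word_term :: "'m letter list \<Rightarrow> 'm iterm" where
  "word_term [] = IOne"
| "word_term (l # u) = IMul (letter_term l) (word_term u)"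

lemma letter_term_terms: "l \<in> Pos ` G \<union> Neg ` G \<Longrightarrow> letter_term l \<in> iterms G"
  by auto

lemma word_term_terms: "u \<in> lists (Pos ` G \<union> Neg ` G) \<Longrightarrow> word_term u \<in> iterms G"
  by (induction u) auto

lemma word_ext_append:
  assumes "monoid S" "f \<in> L \<rightarrow> carrier S" "u \<in> lists L" "v \<in> lists L"
  shows "word_ext S f (u @ v) = word_ext S f u \<otimes>\<^bsub>S\<^esub> word_ext S f v"
proof -
  interpret monoid S by fact
  note c = word_ext_closed[OF assms(1,2)]
  show ?thesis
    using assms(3)
  proof (induction u)
    case (Cons l u)
    then show ?case using assms(2) c[of u] c[OF assms(4)] by (simp add: m_assoc Pi_iff)
  qed (use c[OF assms(4)] in simp)
qed

section \<open>The action of \<open>FI\<^sub>R(M)\<close> on the projections of \<open>FR\<^sub>R(M)\<close>\<close>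

locale monoid_with_identities =
  fixes M :: "('m, 'c) monoid_scheme"
    and X :: "'x set"
    and R :: "'x list rterm set rel"
  assumes monoid_M: "monoid M"
    and identities: "pq \<in> R \<Longrightarrow> identity_over X pq"
begin

abbreviation F where "F \<equiv> FR M X R"
abbreviation I where "I \<equiv> FI M X R"
abbreviation P where "P \<equiv> projections F"
abbreviation gen where "gen \<equiv> FR_gen M X R"
abbreviation \<psi> where "\<psi> \<equiv> psi M X R"
abbreviation letter where "letter \<equiv> letter_value M X R"
abbreviation val where "val \<equiv> FI_value M X R"
abbreviation cls where "cls t \<equiv> icong (carrier M) (FI_rels M X R) `` {t}"

sublocale F: restriction_monoid F by (rule restriction_monoid_FR)
sublocale I: inverse_monoid I by (rule inverse_monoid_FI)

text \<open>Each generator acts as the Munn partial bijection of the corresponding generator of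
  FR_R(M). The definition is on terms and descends to FI_R(M) by \<open>act_cong\<close>.\<close>

definition act :: "'m iterm \<Rightarrow> 'm rterm set rel" where
  "act = ieval (symmetric_inverse_monoid P) (\<lambda>m. F.munn (gen m))"

lemma gen_closed: "gen \<in> carrier M \<rightarrow> carrier F"
  by (auto simp: FR_def FR_gen_def intro!: rclass_carrier)

lemma munn_gen_closed:
  "(\<lambda>m. F.munn (gen m)) \<in> carrier M \<rightarrow> carrier (symmetric_inverse_monoid P)"
  using F.munn_hom gen_closed
  by (auto simp: restriction_hom_def hom_def restriction_of_def Pi_iff)

text \<open>Evaluation commutes with the morphism \<open>munn\<close>, and a term evaluated in
  FR_R(M) at the generators gives its own class.\<close>

lemma act_to_iterm:
  assumes "t \<in> rterms (carrier M)"
  shows "act (to_iterm t) = F.munn (rcong (carrier M) (FR_rels M X R) `` {t})"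
  using reval_hom[OF restriction_monoid_FR F.munn_hom gen_closed assms]
  by (simp add: act_def ieval_to_iterm reval_FR[OF assms])

text \<open>A defining relation of FI_R(M) is the translation of one of FR_R(M), which holds in
  FR_R(M) and hence between the partial bijections.\<close>

lemma act_rels:
  assumes "(s, t) \<in> FI_rels M X R"
  shows "act s = act t"
proof -
  obtain a b where ab: "(a, b) \<in> FR_rels M X R" "s = to_iterm a" "t = to_iterm b"
    using assms by (auto simp: FI_rels_def)
  have c: "a \<in> rterms (carrier M)" "b \<in> rterms (carrier M)"
    using FR_rels_terms[OF monoid_M identities ab(1)] by auto
  have "(a, b) \<in> rcong (carrier M) (FR_rels M X R)"
    using ab(1) c by (intro rcong.rel) auto
  then show ?thesis
    using act_to_iterm c ab(2,3) equiv_class_eq[OF equiv_rcong] by metis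
qed

lemma act_cong: "(s, t) \<in> icong (carrier M) (FI_rels M X R) \<Longrightarrow> act s = act t"
  unfolding act_def
  by (rule ieval_sound[OF inverse_monoid_symmetric munn_gen_closed])
    (use act_rels in \<open>simp_all add: act_def\<close>)

section \<open>The recursion for D_u and images of ideals under the action\<close>

lemma D_step_projection:
  assumes "d \<in> P" "l \<in> Pos ` carrier M \<union> Neg ` carrier M"
  shows "D_step M X R d l \<in> P"
  using assms gen_closed F.projection_closed
  by (auto simp: Pi_iff intro!: F.rstar_projection F.rplus_projection)

lemma act_letter_Image:
  assumes "d \<in> P" "l \<in> Pos ` carrier M \<union> Neg ` carrier M"
  shows "act (letter_term l) `` F.below d = F.below (D_step M X R d l)"
  using assms(2)
proof
  assume "l \<in> Pos ` carrier M"
  then show ?thesis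
    using F.munn_Image_below[OF funcset_mem[OF gen_closed] assms(1)]
    by (elim imageE) (simp add: act_def)
next
  assume "l \<in> Neg ` carrier M"
  then show ?thesis
    using F.munn_converse_Image_below[OF funcset_mem[OF gen_closed] assms(1)]
    by (elim imageE) (simp add: act_def symmetric_inverse_monoid_def)
qed

text \<open>The projection d is kept arbitrary because \<open>foldl\<close> changes it with each
  letter. Composition of relations lets the first letter act first, the order in which
  \<open>foldl\<close> reads the word.\<close>

lemma act_word_Image:
  assumes "d \<in> P" "u \<in> letter_words M"
  shows "act (word_term u) `` F.below d = F.below (foldl (D_step M X R) d u)"
  using assms
proof (induction u arbitrary: d)
  case Nil
  then show ?case by (auto simp: act_def symmetric_inverse_monoid_def F.below_def)
next
  case (Cons l u)
  then have l: "l \<in> Pos ` carrier M \<union> Neg ` carrier M" and u: "u \<in> letter_words M" by auto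
  have "act (word_term (l # u)) `` F.below d
      = act (word_term u) `` (act (letter_term l) `` F.below d)"
    by (simp add: act_def symmetric_inverse_monoid_def relcomp_Image)
  then show ?case
    using Cons.IH[OF D_step_projection[OF Cons.prems(1) l] u] act_letter_Image[OF Cons.prems(1) l]
    by simp
qed

lemma D_fold_projection:
  "d \<in> P \<Longrightarrow> u \<in> letter_words M \<Longrightarrow> foldl (D_step M X R) d u \<in> P"
  by (induction u arbitrary: d) (use D_step_projection in auto)

lemma D_word_projection: "u \<in> letter_words M \<Longrightarrow> D_word M X R u \<in> P"
  unfolding D_word_def by (rule D_fold_projection[OF F.one_projection])

lemma act_word_Image_projections:
  "u \<in> letter_words M \<Longrightarrow> act (word_term u) `` P = F.below (D_word M X R u)"
  using act_word_Image[OF F.one_projection, of u] F.below_one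
  by (simp add: D_word_def)

section \<open>Words as representatives of the elements of \<open>FI\<^sub>R(M)\<close>\<close>

lemma letter_value_class:
  "l \<in> Pos ` carrier M \<union> Neg ` carrier M \<Longrightarrow> letter l = cls (letter_term l)"
  by (auto simp: FI_gen_def FI_def ipres_minv)

lemma FI_value_class: "u \<in> letter_words M \<Longrightarrow> val u = cls (word_term u)"
proof (induction u)
  case Nil
  then show ?case by (simp add: FI_value_def FI_def ipres_one)
next
  case (Cons l u)
  then have l: "l \<in> Pos ` carrier M \<union> Neg ` carrier M" and u: "u \<in> letter_words M" by auto
  show ?case
    using Cons.IH[OF u] letter_value_class[OF l] letter_term_terms[OF l] word_term_terms[OF u]
    by (simp add: FI_value_def FI_def ipres_mult)
qed

lemma letter_closed: "letter \<in> Pos ` carrier M \<union> Neg ` carrier M \<rightarrow> carrier I"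
proof (rule Pi_I)
  fix l assume "l \<in> Pos ` carrier M \<union> Neg ` carrier M"
  then show "letter l \<in> carrier I"
    using letter_value_class letter_term_terms iclass_carrier unfolding FI_def by metis
qed

lemma FI_value_closed: "u \<in> letter_words M \<Longrightarrow> val u \<in> carrier I"
  unfolding FI_value_def by (rule word_ext_closed[OF I.monoid_axioms letter_closed])

lemma FI_value_append:
  "u \<in> letter_words M \<Longrightarrow> v \<in> letter_words M \<Longrightarrow> val (u @ v) = val u \<otimes>\<^bsub>I\<^esub> val v"
  unfolding FI_value_def by (rule word_ext_append[OF I.monoid_axioms letter_closed])

lemma FI_value_singleton: "l \<in> Pos ` carrier M \<union> Neg ` carrier M \<Longrightarrow> val [l] = letter l"
  using letter_closed by (auto simp: FI_value_def Pi_iff)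

lemma letter_minv:
  assumes "l \<in> Pos ` carrier M \<union> Neg ` carrier M"
  shows "minv I (letter l) \<in> val ` letter_words M"
proof -
  obtain l' where l': "l' \<in> Pos ` carrier M \<union> Neg ` carrier M" "minv I (letter l) = letter l'"
  proof (cases l)
    case (Pos m)
    then show ?thesis using assms that[of "Neg m"] by auto
  next
    case (Neg m)
    then have m: "m \<in> carrier M" using assms by auto
    then have "FI_gen M X R m \<in> carrier I" using funcset_mem[OF letter_closed, of "Pos m"] by simp
    then show ?thesis using that[of "Pos m"] m Neg by (simp add: I.minv_minv)
  qed
  have "val [l'] \<in> val ` letter_words M" using l'(1) by (intro imageI) simp
  then show ?thesis using l' FI_value_singleton by simp
qed

lemma FI_values_mult:
  assumes "x \<in> val ` letter_words M" "y \<in> val ` letter_words M"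
  shows "x \<otimes>\<^bsub>I\<^esub> y \<in> val ` letter_words M"
proof -
  obtain u v where uv: "u \<in> letter_words M" "x = val u" "v \<in> letter_words M" "y = val v"
    using assms by blast
  then have "val (u @ v) \<in> val ` letter_words M" by (intro imageI) simp
  then show ?thesis using uv FI_value_append by simp
qed

text \<open>Inversion reverses the word and inverts its letters, and the inverse of a letter is the
  value of a letter again.\<close>

lemma FI_values_minv: "u \<in> letter_words M \<Longrightarrow> minv I (val u) \<in> val ` letter_words M"
proof (induction u)
  case Nil
  have "minv I (val []) = val []" by (simp add: FI_value_def I.minv_idem)
  then show ?case by (simp only: imageI lists.Nil)
next
  case (Cons l u)
  then have l: "l \<in> Pos ` carrier M \<union> Neg ` carrier M" and u: "u \<in> letter_words M" by auto
  have "val (l # u) = letter l \<otimes>\<^bsub>I\<^esub> val u" by (simp add: FI_value_def)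
  then have "minv I (val (l # u)) = minv I (val u) \<otimes>\<^bsub>I\<^esub> minv I (letter l)"
    using I.minv_mult[OF _ FI_value_closed[OF u]] letter_closed l by (simp add: Pi_iff)
  then show ?case using FI_values_mult[OF Cons.IH[OF u] letter_minv[OF l]] by simp
qed

text \<open>The values of words contain the generators and the identity and are closed under
  products and inverses, so induction on terms reaches every class.\<close>

lemma FI_value_surj:
  assumes "x \<in> carrier I"
  obtains u where "u \<in> letter_words M" "x = val u"
proof -
  obtain t where t: "t \<in> iterms (carrier M)" "x = cls t"
    using assms unfolding FI_def by (rule ipres_carrierE)
  have "cls t \<in> val ` letter_words M"
    using t(1)
  proof (induction t)
    case (IGen m)
    then have "val [Pos m] \<in> val ` letter_words M" by (intro imageI) auto
    then show ?case using IGen FI_value_singleton[of "Pos m"] by (simp add: FI_gen_def)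
  next
    case IOne
    have "cls IOne = val []" by (simp add: FI_value_def FI_def ipres_one)
    then show ?case by (simp only: imageI lists.Nil)
  next
    case (IMul s t)
    then have c: "s \<in> iterms (carrier M)" "t \<in> iterms (carrier M)" by auto
    show ?case using FI_values_mult[OF IMul.IH(1)[OF c(1)] IMul.IH(2)[OF c(2)]] ipres_mult[OF c]
      by (simp add: FI_def)
  next
    case (IInv t)
    then have c: "t \<in> iterms (carrier M)" by auto
    obtain u where u: "u \<in> letter_words M" "cls t = val u" using IInv.IH[OF c] by auto
    show ?case using FI_values_minv[OF u(1)] ipres_minv[OF c, of "FI_rels M X R"]
      by (simp add: FI_def flip: u(2))
  qed
  then show ?thesis using that t(2) by auto
qed

section \<open>The two maps are mutually inverse\<close>

text \<open>This is the well-definedness of D: words with the same value act alike, so they map P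
  onto the same ideal, and an ideal determines its generator.\<close>

lemma D_FI_value:
  assumes u: "u \<in> letter_words M"
  shows "D M X R (val u) = D_word M X R u"
  unfolding D_def
proof (rule the_equality)
  show "\<exists>v\<in>letter_words M. val v = val u \<and> D_word M X R u = D_word M X R v" using u by auto
  fix d assume "\<exists>v\<in>letter_words M. val v = val u \<and> d = D_word M X R v"
  then obtain v where v: "v \<in> letter_words M" "val v = val u" "d = D_word M X R v" by auto
  have "(word_term v, word_term u) \<in> icong (carrier M) (FI_rels M X R)"
    using v(2) FI_value_class u v(1) iclass_eq_iff word_term_terms by metis
  then have "act (word_term v) = act (word_term u)" by (rule act_cong)
  then have "F.below (D_word M X R v) = F.below (D_word M X R u)"
    using act_word_Image_projections u v(1) by metis
  then show "d = D_word M X R u"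
    using F.below_inject D_word_projection u v by simp
qed

lemma psi_class:
  assumes "t \<in> rterms (carrier M)"
  shows "\<psi> (rcong (carrier M) (FR_rels M X R) `` {t}) = cls (to_iterm t)"
proof -
  have g: "FI_gen M X R \<in> carrier M \<rightarrow> carrier (restriction_of I)"
    by (rule Pi_I) (rule FI_gen_closed)
  show ?thesis
    unfolding psi_def
    using rlift_class[OF restriction_monoid_FI g reval_FI_rels[OF monoid_M identities] assms]
    by (simp add: reval_FI[OF assms])
qed

text \<open>A word u with value \<open>\<psi> p\<close> acts like the translation of a term for p,
  that is, as the identity on the ideal of p. The image of P is thus this ideal, but it is also the
  ideal of D_u.\<close>

lemma D_psi:
  assumes p: "p \<in> P"
  shows "D M X R (\<psi> p) = p"
proof -
  obtain t where t: "t \<in> rterms (carrier M)" "p = rcong (carrier M) (FR_rels M X R) `` {t}"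
    using F.projection_closed[OF p] unfolding FR_def by (rule rpres_carrierE)
  note ti = to_iterm_terms[OF t(1)]
  have "\<psi> p \<in> carrier I" using psi_class[OF t(1)] t(2) ti by (simp add: FI_def iclass_carrier)
  then obtain u where u: "u \<in> letter_words M" "\<psi> p = val u" by (rule FI_value_surj)
  have "cls (word_term u) = cls (to_iterm t)"
    using u psi_class[OF t(1)] t(2) FI_value_class by simp
  then have "act (word_term u) = act (to_iterm t)"
    using act_cong iclass_eq_iff[OF word_term_terms[OF u(1)] ti] by blast
  also have "\<dots> = Id_on (F.below p)"
    using act_to_iterm[OF t(1)] t(2) F.munn_projection[OF p] by simp
  finally have "F.below p = F.below (D_word M X R u)"
    using act_word_Image_projections[OF u(1)] by (auto simp: F.below_def)
  then have "D_word M X R u = p" using F.below_inject D_word_projection[OF u(1)] p by simp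
  then show ?thesis using D_FI_value u by simp
qed

section \<open>The effect of psi on the elements D_u\<close>

lemma psi_mult: "x \<in> carrier F \<Longrightarrow> y \<in> carrier F \<Longrightarrow> \<psi> (x \<otimes>\<^bsub>F\<^esub> y) = \<psi> x \<otimes>\<^bsub>I\<^esub> \<psi> y"
  and psi_one: "\<psi> \<one>\<^bsub>F\<^esub> = \<one>\<^bsub>I\<^esub>"
  and psi_star: "x \<in> carrier F \<Longrightarrow> \<psi> (rstar F x) = minv I (\<psi> x) \<otimes>\<^bsub>I\<^esub> \<psi> x"
  and psi_plus: "x \<in> carrier F \<Longrightarrow> \<psi> (rplus F x) = \<psi> x \<otimes>\<^bsub>I\<^esub> minv I (\<psi> x)"
  and psi_closed: "x \<in> carrier F \<Longrightarrow> \<psi> x \<in> carrier I"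
  using psi_hom(1)[OF monoid_M identities]
  by (auto simp: restriction_hom_def hom_def restriction_of_def Pi_iff)

lemma psi_projection: "p \<in> P \<Longrightarrow> \<psi> p \<in> idempotents I"
  using psi_star psi_closed I.idem_l I.minv_closed
  by (auto simp: projections_def idempotents_def)

text \<open>Letters act on idempotents by conjugation. Write d also for its idempotent image and g
  for [m]. Then (dg)^* is sent to (dg)^-1 (dg) = g^-1 d g, and for the letter g^-1 the element
  (gd)^+ is sent to (gd)(gd)^-1 = g d g^-1.\<close>

lemma psi_D_step:
  assumes d: "d \<in> P" and l: "l \<in> Pos ` carrier M \<union> Neg ` carrier M"
  shows "\<psi> (D_step M X R d l) = minv I (letter l) \<otimes>\<^bsub>I\<^esub> \<psi> d \<otimes>\<^bsub>I\<^esub> letter l"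
proof -
  note dc = F.projection_closed[OF d]
  note c = psi_closed[OF dc]
  have e: "\<psi> d \<otimes>\<^bsub>I\<^esub> \<psi> d = \<psi> d" using psi_projection[OF d] by (simp add: idempotents_def)
  have m: "minv I (\<psi> d) = \<psi> d" by (rule I.minv_idem[OF c e])
  have ee: "\<psi> d \<otimes>\<^bsub>I\<^esub> (\<psi> d \<otimes>\<^bsub>I\<^esub> x) = \<psi> d \<otimes>\<^bsub>I\<^esub> x" if "x \<in> carrier I" for x
    using e c that by (simp flip: I.m_assoc)
  have g: "gen k \<in> carrier F" "FI_gen M X R k \<in> carrier I" "\<psi> (gen k) = FI_gen M X R k"
    if "k \<in> carrier M" for k
    using that gen_closed FI_gen_closed[of k M X R] psi_hom(2)[OF monoid_M identities]
    by (auto simp: Pi_iff restriction_of_def)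
  show ?thesis
    using l
  proof
    assume "l \<in> Pos ` carrier M"
    then show ?thesis
      using g c dc by (auto simp: psi_star psi_mult I.minv_mult I.minv_closed I.m_assoc m ee)
  next
    assume "l \<in> Neg ` carrier M"
    then show ?thesis
      using g c dc
      by (auto simp: psi_plus psi_mult I.minv_mult I.minv_closed I.minv_minv I.m_assoc m ee)
  qed
qed

text \<open>Conjugations by the letters compose to conjugation by the value of u; started at d = 1
  this yields u^-1 u.\<close>

lemma psi_D_fold:
  assumes "d \<in> P" "u \<in> letter_words M"
  shows "\<psi> (foldl (D_step M X R) d u) = minv I (val u) \<otimes>\<^bsub>I\<^esub> \<psi> d \<otimes>\<^bsub>I\<^esub> val u"
  using assms
proof (induction u arbitrary: d)
  case Nil
  then show ?case
    using psi_closed[OF F.projection_closed] by (simp add: FI_value_def I.minv_idem)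
next
  case (Cons l u)
  then have l: "l \<in> Pos ` carrier M \<union> Neg ` carrier M" and u: "u \<in> letter_words M" by auto
  have c: "letter l \<in> carrier I" "val u \<in> carrier I" "\<psi> d \<in> carrier I"
    using letter_closed l FI_value_closed[OF u] psi_closed[OF F.projection_closed[OF Cons.prems(1)]]
    by (auto simp: Pi_iff)
  have "val (l # u) = letter l \<otimes>\<^bsub>I\<^esub> val u" by (simp add: FI_value_def)
  then show ?case
    using Cons.IH[OF D_step_projection[OF Cons.prems(1) l] u] psi_D_step[OF Cons.prems(1) l] c
    by (simp add: I.minv_mult I.minv_closed I.m_assoc)
qed

lemma psi_D:
  assumes "e \<in> idempotents I"
  shows "\<psi> (D M X R e) = e" and "D M X R e \<in> P"
proof -
  have e: "e \<in> carrier I" "e \<otimes>\<^bsub>I\<^esub> e = e" using assms by (auto simp: idempotents_def)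
  obtain u where u: "u \<in> letter_words M" "e = val u" using e(1) by (rule FI_value_surj)
  show "D M X R e \<in> P" using D_FI_value D_word_projection u by simp
  have "\<psi> (D M X R e) = minv I e \<otimes>\<^bsub>I\<^esub> \<one>\<^bsub>I\<^esub> \<otimes>\<^bsub>I\<^esub> e"
    using D_FI_value[OF u(1)] psi_D_fold[OF F.one_projection u(1)] u(2) psi_one
    by (simp add: D_word_def)
  then show "\<psi> (D M X R e) = e" using e I.minv_idem by simp
qed

section \<open>The two isomorphisms of semilattices\<close>

lemma psi_iso: "\<psi> \<in> iso (F\<lparr>carrier := P\<rparr>) (I\<lparr>carrier := idempotents I\<rparr>)"
proof -
  have "bij_betw \<psi> P (idempotents I)"
    by (rule bij_betw_byWitness[of _ "D M X R"]) (auto simp: D_psi psi_D psi_projection)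
  then show ?thesis
    by (simp add: iso_def hom_def psi_projection psi_mult F.projection_closed)
qed

lemma D_iso: "D M X R \<in> iso (I\<lparr>carrier := idempotents I\<rparr>) (F\<lparr>carrier := P\<rparr>)"
proof -
  have "bij_betw (D M X R) (idempotents I) P"
    by (rule bij_betw_byWitness[of _ \<psi>]) (auto simp: D_psi psi_D psi_projection)
  \<comment> \<open>The product of D_e and D_f is a projection that psi sends to ef, so applying D
    to ef returns this product.\<close>
  moreover have "D M X R (e \<otimes>\<^bsub>I\<^esub> f) = D M X R e \<otimes>\<^bsub>F\<^esub> D M X R f"
    if "e \<in> idempotents I" "f \<in> idempotents I" for e f
    using D_psi[OF F.projection_mult[OF psi_D(2)[OF that(1)] psi_D(2)[OF that(2)]]] that
    by (simp add: psi_mult psi_D F.projection_closed)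
  ultimately show ?thesis by (simp add: iso_def hom_def psi_D)
qed

end

theorem corollary7p13:
  fixes M :: "('m, 'c) monoid_scheme"
    and X :: "'x set"
    and R :: "'x list rterm set rel"
  assumes "monoid M"
    and "\<forall>pq\<in>R. admissible X pq"
  shows "D M X R \<in> iso ((FI M X R)\<lparr>carrier := idempotents (FI M X R)\<rparr>)
                         ((FR M X R)\<lparr>carrier := projections (FR M X R)\<rparr>)
    \<and> psi M X R \<in> iso ((FR M X R)\<lparr>carrier := projections (FR M X R)\<rparr>)
                       ((FI M X R)\<lparr>carrier := idempotents (FI M X R)\<rparr>)
    \<and> (\<forall>d\<in>projections (FR M X R). inv_into (idempotents (FI M X R)) (D M X R) d = psi M X R d)
    \<and> (\<forall>e\<in>idempotents (FI M X R). psi M X R (D M X R e) = e)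
    \<and> (\<forall>e\<in>projections (FR M X R). D M X R (psi M X R e) = e)"
proof -
  interpret monoid_with_identities M X R
    by (rule monoid_with_identities.intro) (use assms in \<open>auto simp: admissible_def\<close>)
  have "inv_into (idempotents I) (D M X R) d = \<psi> d" if "d \<in> P" for d
  proof (rule inv_into_f_eq)
    show "inj_on (D M X R) (idempotents I)" by (rule inj_on_inverseI) (rule psi_D)
  qed (simp_all add: that psi_projection D_psi)
  then show ?thesis by (simp add: D_iso psi_iso psi_D D_psi)
qed

end
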